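(* Let $d\ge2$, let $\mathbf X_1,\dots,\mathbf X_n$ be i.i.d. random vectors in $\mathbb R^d$ with continuous marginal distribution functions, copula $C$ and copula density $c$. Assume that $c\in L^2([0,1]^d)$. Let $\mathbf N=\mathbf N(n)\in\mathbb N^d$ be such that $N_j(n)\to\infty$ for all $j=1,\dots,d$ and $N_{\max}^{2d+4}=o(n)$ as $n\to\infty$, where $N_{\max}=\max_{1\le j\le d}N_j$. Then for any $\mathbf u\in[0,1]^d$, as $n\to\infty$, $$\mathbb E\big(\widehat c^{[\mathbf N]}(\mathbf u)\big)\longrightarrow c(\mathbf u)\qquad\text{and}\qquad\mathbb E\big(\widehat C^{[\mathbf N]}(\mathbf u)\big)\longrightarrow C(\mathbf u).$$
   Context: $\mathbb N=\{0,1,2,\dots\}$. $Q_m(x)=\sqrt{2m+1}\,L_m(2x-1)$, $x\in[0,1]$, are the orthonormal shifted Legendre polynomials, where $L_0=1$, $L_1(x)=x$, $(m+1)L_{m+1}(x)=(2m+1)xL_m(x)-mL_{m-1}(x)$. Write $\mathbf X_i=(X_{i1},\dots,X_{id})^T$ with marginal distribution functions $F_1,\dots,F_d$, and $\widehat F_j(x)=\frac1n\sum_{i=1}^n\mathbf 1(X_{ij}\le x)$. The copula $C$ is the distribution function, and $c$ the Lebesgue density on $[0,1]^d$, of $(F_1(X_{11}),\dots,F_d(X_{1d}))$. For $\mathbf m\in\mathbb N^d$: $\widehat\rho_{\mathbf m}=1$ if $\mathbf m=\mathbf 0$; $\widehat\rho_{\mathbf m}=0$ if exactly $d-1$ components of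 $\mathbf m$ are zero; and $\widehat\rho_{\mathbf m}=\frac1n\sum_{i=1}^n\prod_{j=1}^dQ_{m_j}(\widehat F_j(X_{ij}))$ otherwise. With $\mathbf m\le\mathbf N$ meaning $m_j\le N_j$ for all $j$, $\widehat c^{[\mathbf N]}(\mathbf u)=\sum_{\mathbf m\le\mathbf N}\widehat\rho_{\mathbf m}\prod_{j=1}^dQ_{m_j}(u_j)$ and $\widehat C^{[\mathbf N]}(\mathbf u)=\sum_{\mathbf m\le\mathbf N}\widehat\rho_{\mathbf m}\prod_{j=1}^d\int_0^{u_j}Q_{m_j}(x_j)\,dx_j$.
   Formalization: The convergence of E ĉ(u) to c(u) is stated only at points u where the Legendre series of c converges (rectangular partial sums, all N_j → ∞) to c(u); for an arbitrary version of c it fails, e.g. c = 1 changed at one point. The convergence to C(u) is for all u. *)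

theory Defs
  imports "HOL-Probability.Probability" "HOL-Library.Landau_Symbols"
begin

fun legendre :: "nat \<Rightarrow> real \<Rightarrow> real" where
  "legendre 0 x = 1"
| "legendre (Suc 0) x = x"
| "legendre (Suc (Suc m)) x =
     ((2 * real m + 3) * x * legendre (Suc m) x - (real m + 1) * legendre m x) / (real m + 2)"

definition shifted_legendre :: "nat \<Rightarrow> real \<Rightarrow> real" where
  "shifted_legendre m x = sqrt (2 * real m + 1) * legendre m (2 * x - 1)"

definition unit_cube :: "(real ^ 'd) set" where
  "unit_cube = {u. \<forall>j. 0 \<le> u $ j \<and> u $ j \<le> 1}"

definition marginal_cdf :: "'a measure \<Rightarrow> ('a \<Rightarrow> real ^ 'd) \<Rightarrow> 'd \<Rightarrow> real \<Rightarrow> real" where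
  "marginal_cdf M Y j = cdf (distr M borel (\<lambda>\<omega>. Y \<omega> $ j))"

definition pit :: "'a measure \<Rightarrow> ('a \<Rightarrow> real ^ 'd) \<Rightarrow> 'a \<Rightarrow> real ^ 'd" where
  "pit M Y \<omega> = (\<chi> j. marginal_cdf M Y j (Y \<omega> $ j))"

definition copula :: "'a measure \<Rightarrow> ('a \<Rightarrow> real ^ 'd) \<Rightarrow> real ^ 'd \<Rightarrow> real" where
  "copula M Y u = measure M {\<omega> \<in> space M. \<forall>j. pit M Y \<omega> $ j \<le> u $ j}"

(* Only the values of c on the unit cube are relevant. Any version of the density is allowed. *)
definition copula_density ::
  "'a measure \<Rightarrow> ('a \<Rightarrow> real ^ 'd) \<Rightarrow> (real ^ 'd \<Rightarrow> real) \<Rightarrow> bool" where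
  "copula_density M Y c \<longleftrightarrow>
     (\<forall>u\<in>unit_cube. 0 \<le> c u) \<and>
     distributed M lborel (pit M Y) (\<lambda>u. ennreal (indicator unit_cube u * c u))"

(* The sample of size n consists of X 0, ..., X (n - 1). *)
definition emp_cdf ::
  "(nat \<Rightarrow> 'a \<Rightarrow> real ^ 'd) \<Rightarrow> nat \<Rightarrow> 'a \<Rightarrow> 'd \<Rightarrow> real \<Rightarrow> real" where
  "emp_cdf X n \<omega> j x = (1 / real n) * (\<Sum>i<n. indicator {..x} (X i \<omega> $ j))"

definition rho_hat ::
  "(nat \<Rightarrow> 'a \<Rightarrow> real ^ 'd) \<Rightarrow> nat \<Rightarrow> ('d \<Rightarrow> nat) \<Rightarrow> 'a \<Rightarrow> real" where
  "rho_hat X n m \<omega> =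
     (if \<forall>j. m j = 0 then 1
      else if card {j. m j = 0} = CARD('d) - 1 then 0
      else (1 / real n) *
        (\<Sum>i<n. \<Prod>j\<in>UNIV. shifted_legendre (m j) (emp_cdf X n \<omega> j (X i \<omega> $ j))))"

(* Functions are ordered pointwise, so {..N} is the set of all multi-indices m with
   m j \<le> N j for all j. *)
definition c_hat ::
  "(nat \<Rightarrow> 'a \<Rightarrow> real ^ 'd) \<Rightarrow> nat \<Rightarrow> ('d \<Rightarrow> nat) \<Rightarrow> real ^ 'd \<Rightarrow> 'a \<Rightarrow> real" where
  "c_hat X n N u \<omega> =
     (\<Sum>m\<in>{..N}. rho_hat X n m \<omega> * (\<Prod>j\<in>UNIV. shifted_legendre (m j) (u $ j)))"

definition C_hat ::
  "(nat \<Rightarrow> 'a \<Rightarrow> real ^ 'd) \<Rightarrow> nat \<Rightarrow> ('d \<Rightarrow> nat) \<Rightarrow> real ^ 'd \<Rightarrow> 'a \<Rightarrow> real" where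
  "C_hat X n N u \<omega> =
     (\<Sum>m\<in>{..N}. rho_hat X n m \<omega> *
        (\<Prod>j\<in>UNIV. integral {0..u $ j} (shifted_legendre (m j))))"

definition legendre_coeff :: "(real ^ 'd \<Rightarrow> real) \<Rightarrow> ('d \<Rightarrow> nat) \<Rightarrow> real" where
  "legendre_coeff c m =
     (LINT u:unit_cube|lborel. c u * (\<Prod>j\<in>UNIV. shifted_legendre (m j) (u $ j)))"

definition legendre_partial_sum ::
  "(real ^ 'd \<Rightarrow> real) \<Rightarrow> ('d \<Rightarrow> nat) \<Rightarrow> real ^ 'd \<Rightarrow> real" where
  "legendre_partial_sum c N u =
     (\<Sum>m\<in>{..N}. legendre_coeff c m * (\<Prod>j\<in>UNIV. shifted_legendre (m j) (u $ j)))"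

(* A density in L2 is determined only almost everywhere; its value at a single point u is
   understood as the sum at u of its Legendre series.  The predicate says that this series
   converges at u and that the chosen version c has that value.  Since at_top on multi-indices is
   generated by the sets {N. K \<le> N}, with the pointwise order, the limit is the one of
   rectangular partial sums as all N j tend to infinity independently of each other. *)
definition legendre_representable_at :: "(real ^ 'd \<Rightarrow> real) \<Rightarrow> real ^ 'd \<Rightarrow> bool" where
  "legendre_representable_at c u \<longleftrightarrow>
     ((\<lambda>N. legendre_partial_sum c N u) \<longlongrightarrow> c u) at_top"

end

theory Submission
  imports Defs
begin

text \<open>The error splits into the bias of the empirical coefficients and the truncation error of the
  Legendre series of \<open>c\<close>. For the bias, a second-order Taylor expansion around the exact ranks
  \<open>F\<^sub>j(X\<^sub>i\<^sub>j)\<close> is used: conditionally on \<open>X\<^sub>i\<close> the linear term has mean of order \<open>1/n\<close>, and so has the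
  quadratic one, because the variance of the empirical distribution function is at most \<open>1/n\<close>. With
  \<open>\<bar>L\<^sub>m\<bar> \<le> 1\<close>, \<open>\<bar>L\<^sub>m'\<bar> = O(m\<^sup>2)\<close> and \<open>\<bar>L\<^sub>m''\<bar> = O(m\<^sup>4)\<close> the biases add up to \<open>O(N\<^sub>m\<^sub>a\<^sub>x\<close> to the power \<open>2d+4\<close>,
  divided by \<open>n)\<close>. The truncated series of \<open>C(u)\<close> is the inner product of \<open>c\<close> with the product of the
  one-dimensional Legendre partial sums of the indicators of \<open>[0,u\<^sub>j]\<close>. These converge in \<open>L\<^sup>2\<close>: the
  derivative with respect to \<open>u\<close> of the Parseval sum telescopes to \<open>1 + L\<^sub>n L\<^sub>n\<^sub>+\<^sub>1\<close>, so the sum differs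
  from \<open>u\<close> by at most \<open>1/(2n+1)\<close>.\<close>

section \<open>Legendre polynomials\<close>

declare legendre.simps(3) [simp del]

lemma legendre_recurrence:
  "(real m + 2) * legendre (Suc (Suc m)) x
    = (2 * real m + 3) * x * legendre (Suc m) x - (real m + 1) * legendre m x"
  by (simp add: legendre.simps(3))

text \<open>The left-hand side is nonincreasing in \<open>m\<close>. For Chebyshev polynomials it would be constant.\<close>

lemma legendre_energy:
  assumes "\<bar>x\<bar> \<le> 1"
  shows "(legendre m x - x * legendre (Suc m) x)\<^sup>2 + (1 - x\<^sup>2) * (legendre (Suc m) x)\<^sup>2 \<le> 1 - x\<^sup>2"
proof (induction m)
  case 0
  show ?case by (simp add: power2_eq_square algebra_simps)
next
  case (Suc m)
  define a b d where "a = legendre m x" and "b = legendre (Suc m) x"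
    and "d = legendre (Suc (Suc m)) x"
  define t where "t = (real m + 1) / (real m + 2)"
  have t: "0 \<le> t" "t \<le> 1"
    by (auto simp: t_def)
  have "d * (real m + 2) = (2 * real m + 3) * x * b - (real m + 1) * a"
    using legendre_recurrence[of m x] by (simp add: a_def b_def d_def mult.commute)
  then have d: "d - x * b = t * (x * b - a)"
    by (simp add: t_def field_simps)
  \<comment> \<open>The form \<open>b\<^sup>2 - 2 * x * b * d + d\<^sup>2\<close> is symmetric, so
    the square can be completed in either variable; the recurrence then shrinks the completed square
    by \<open>t\<^sup>2\<close>.\<close>
  have "(b - x * d)\<^sup>2 + (1 - x\<^sup>2) * d\<^sup>2 = (d - x * b)\<^sup>2 + (1 - x\<^sup>2) * b\<^sup>2"
    by (simp add: power2_eq_square algebra_simps)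
  also have "\<dots> = t\<^sup>2 * (a - x * b)\<^sup>2 + (1 - x\<^sup>2) * b\<^sup>2"
    by (simp add: d power_mult_distrib power2_commute)
  also have "\<dots> \<le> 1 * (a - x * b)\<^sup>2 + (1 - x\<^sup>2) * b\<^sup>2"
    using t by (intro add_mono mult_right_mono) (auto simp: power_le_one)
  also have "\<dots> \<le> 1 - x\<^sup>2"
    using Suc by (simp add: a_def b_def)
  finally show ?case
    by (simp add: b_def d_def)
qed

lemma legendre_one [simp]: "legendre m 1 = 1"
  by (induction m rule: induct_nat_012) (auto simp: legendre.simps(3) field_simps)

lemma legendre_minus_one: "legendre m (- 1) = (- 1) ^ m"
  by (induction m rule: induct_nat_012) (auto simp: legendre.simps(3) field_simps)

text \<open>Dividing the energy inequality by \<open>1 - x\<^sup>2\<close> leaves the square of the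
  polynomial below 1. This factor vanishes at the endpoints, where the values are known
  explicitly.\<close>

lemma abs_legendre_le:
  assumes "\<bar>x\<bar> \<le> 1"
  shows "\<bar>legendre m x\<bar> \<le> 1"
proof (cases "x = 1 \<or> x = - 1")
  case True
  then show ?thesis by (auto simp: legendre_minus_one)
next
  case False
  then have pos: "1 - x\<^sup>2 > 0"
    using assms abs_square_less_1[of x] by auto
  show ?thesis
  proof (cases m)
    case (Suc k)
    have "(1 - x\<^sup>2) * (legendre m x)\<^sup>2 \<le> (legendre k x - x * legendre m x)\<^sup>2 + (1 - x\<^sup>2) * (legendre m x)\<^sup>2"
      by simp
    also have "\<dots> \<le> (1 - x\<^sup>2) * 1"
      using legendre_energy[OF assms, of k] by (simp add: Suc)
    finally have "(legendre m x)\<^sup>2 \<le> 1"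
      using pos by (simp only: mult_le_cancel_left_pos)
    then show ?thesis
      by (simp add: abs_square_le_1)
  qed simp
qed

section \<open>Derivatives of Legendre polynomials and their bounds\<close>

text \<open>The recursion is the classical identity for the difference of the derivatives at degrees
  \<open>m + 2\<close> and \<open>m\<close>. The triangle inequality carries bounds through it, and
  it yields antiderivatives at once. That these functions are the derivatives is proved
  below.\<close>

fun legendre_deriv :: "nat \<Rightarrow> real \<Rightarrow> real" where
  "legendre_deriv 0 x = 0"
| "legendre_deriv (Suc 0) x = 1"
| "legendre_deriv (Suc (Suc m)) x = legendre_deriv m x + (2 * real m + 3) * legendre (Suc m) x"

fun legendre_deriv2 :: "nat \<Rightarrow> real \<Rightarrow> real" where
  "legendre_deriv2 0 x = 0"
| "legendre_deriv2 (Suc 0) x = 0"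
| "legendre_deriv2 (Suc (Suc m)) x =
     legendre_deriv2 m x + (2 * real m + 3) * legendre_deriv (Suc m) x"

text \<open>An algebraic fact about the recursively defined sequence, established before its members
  are known to be derivatives. One induction proves both identities, since each is derived from the
  other one at the previous degree.\<close>

lemma legendre_deriv_relations:
  "legendre_deriv (Suc m) x - x * legendre_deriv m x = (real m + 1) * legendre m x \<and>
   x * legendre_deriv (Suc m) x - legendre_deriv m x = (real m + 1) * legendre (Suc m) x"
proof (induction m)
  case (Suc m)
  have A: "legendre_deriv (Suc m) x = x * legendre_deriv m x + (real m + 1) * legendre m x"
    and B: "legendre_deriv m x = x * legendre_deriv (Suc m) x - (real m + 1) * legendre (Suc m) x"
    using Suc by auto
  have 1: "legendre_deriv (Suc (Suc m)) x - x * legendre_deriv (Suc m) x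
      = (real (Suc m) + 1) * legendre (Suc m) x"
    by (simp add: B algebra_simps)
  have "x * legendre_deriv (Suc (Suc m)) x - legendre_deriv (Suc m) x
      = (2 * real m + 3) * x * legendre (Suc m) x - (real m + 1) * legendre m x"
    by (simp add: A algebra_simps)
  also have "\<dots> = (real (Suc m) + 1) * legendre (Suc (Suc m)) x"
    using legendre_recurrence[of m x] by (simp add: add.commute)
  finally show ?case using 1 by blast
qed simp

lemma has_real_derivative_legendre [derivative_intros]:
  "(legendre m has_real_derivative legendre_deriv m x) (at x)"
proof (induction m rule: induct_nat_012)
  case 0
  have "legendre 0 = (\<lambda>x. 1)" by auto
  then show ?case by simp
next
  case 1
  have "legendre (Suc 0) = (\<lambda>x. x)" by auto
  then show ?case by simp
next
  case (ge2 m)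
  have eq: "legendre (Suc (Suc m)) = (\<lambda>x. ((2 * real m + 3) * x * legendre (Suc m) x
      - (real m + 1) * legendre m x) / (real m + 2))"
    by (auto simp: legendre.simps(3))
  \<comment> \<open>The differentiated three-term recurrence agrees with the recursion for
    \<open>legendre_deriv\<close> once the second relation eliminates
    \<open>legendre_deriv m x\<close>.\<close>
  have "((2 * real m + 3) * (legendre (Suc m) x + x * legendre_deriv (Suc m) x)
      - (real m + 1) * legendre_deriv m x) / (real m + 2) = legendre_deriv (Suc (Suc m)) x"
  proof -
    have B: "legendre_deriv m x = x * legendre_deriv (Suc m) x - (real m + 1) * legendre (Suc m) x"
      using legendre_deriv_relations[of m x] by auto
    have "(2 * real m + 3) * (legendre (Suc m) x + x * legendre_deriv (Suc m) x)
        - (real m + 1) * legendre_deriv m x = (real m + 2) * legendre_deriv (Suc (Suc m)) x"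
      by (simp add: B algebra_simps)
    then show ?thesis by simp
  qed
  moreover have "(legendre (Suc (Suc m)) has_real_derivative
      ((2 * real m + 3) * (legendre (Suc m) x + x * legendre_deriv (Suc m) x)
        - (real m + 1) * legendre_deriv m x) / (real m + 2)) (at x)"
    unfolding eq
    by (intro DERIV_cdivide DERIV_diff) (auto intro!: derivative_eq_intros ge2 simp: algebra_simps)
  ultimately show ?case
    by simp
qed

lemma has_real_derivative_legendre_deriv [derivative_intros]:
  "(legendre_deriv m has_real_derivative legendre_deriv2 m x) (at x)"
proof (induction m rule: induct_nat_012)
  case 0
  have "legendre_deriv 0 = (\<lambda>x. 0)" by auto
  then show ?case by simp
next
  case 1
  have "legendre_deriv (Suc 0) = (\<lambda>x. 1)" by auto
  then show ?case by simp
next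
  case (ge2 m)
  have eq: "legendre_deriv (Suc (Suc m)) =
      (\<lambda>x. legendre_deriv m x + (2 * real m + 3) * legendre (Suc m) x)"
    by auto
  show ?case
    unfolding eq by (auto intro!: derivative_eq_intros ge2)
qed

text \<open>The bound is the value of the derivative at 1. From degree \<open>m\<close> to
  \<open>m + 2\<close> it grows by exactly \<open>2 * real m + 3\<close>, the most that the
  recursion can add when the polynomials are at most 1 in absolute value.\<close>

lemma abs_legendre_deriv_le:
  assumes "\<bar>x\<bar> \<le> 1"
  shows "\<bar>legendre_deriv m x\<bar> \<le> real m * (real m + 1) / 2"
proof (induction m rule: induct_nat_012)
  case (ge2 m)
  have "\<bar>legendre_deriv (Suc (Suc m)) x\<bar>
      \<le> \<bar>legendre_deriv m x\<bar> + (2 * real m + 3) * \<bar>legendre (Suc m) x\<bar>"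
    by (simp add: abs_mult order.trans[OF abs_triangle_ineq])
  also have "\<dots> \<le> real m * (real m + 1) / 2 + (2 * real m + 3) * 1"
    by (intro add_mono mult_left_mono ge2 abs_legendre_le assms) auto
  also have "\<dots> = real (Suc (Suc m)) * (real (Suc (Suc m)) + 1) / 2"
    by (simp add: field_simps)
  finally show ?case .
qed auto

text \<open>The bound is the square of the one for the first derivative. It is not sharp, but in
  this form the second-order error is the square of the first-order one, as
  \<open>prod_taylor\<close> requires.\<close>

lemma abs_legendre_deriv2_le:
  assumes "\<bar>x\<bar> \<le> 1"
  shows "\<bar>legendre_deriv2 m x\<bar> \<le> (real m * (real m + 1))\<^sup>2 / 4"
proof (induction m rule: induct_nat_012)
  case (ge2 m)
  have "\<bar>legendre_deriv2 (Suc (Suc m)) x\<bar>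
      \<le> \<bar>legendre_deriv2 m x\<bar> + (2 * real m + 3) * \<bar>legendre_deriv (Suc m) x\<bar>"
    by (simp add: abs_mult order.trans[OF abs_triangle_ineq])
  also have "\<dots> \<le> (real m * (real m + 1))\<^sup>2 / 4
      + (2 * real m + 3) * (real (Suc m) * (real (Suc m) + 1) / 2)"
    by (intro add_mono mult_left_mono ge2 abs_legendre_deriv_le assms) auto
  also have "\<dots> \<le> (real (Suc (Suc m)) * (real (Suc (Suc m)) + 1))\<^sup>2 / 4"
    by (simp add: power2_eq_square field_simps)
  finally show ?case .
qed auto

lemma continuous_on_legendre [continuous_intros]:
  assumes "continuous_on S f"
  shows "continuous_on S (\<lambda>x. legendre m (f x))"
proof -
  have "continuous_on UNIV (legendre m)"
    by (meson DERIV_isCont continuous_at_imp_continuous_on has_real_derivative_legendre)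
  then show ?thesis
    using assms by (rule continuous_on_compose2) auto
qed

lemma continuous_on_shifted_legendre [continuous_intros]:
  "continuous_on S f \<Longrightarrow> continuous_on S (\<lambda>x. shifted_legendre m (f x))"
  unfolding shifted_legendre_def by (intro continuous_intros)

lemma shifted_legendre_0 [simp]: "shifted_legendre 0 x = 1"
  by (simp add: shifted_legendre_def)

lemma borel_measurable_shifted_legendre [measurable]: "shifted_legendre m \<in> borel_measurable borel"
  by (intro borel_measurable_continuous_onI continuous_intros)

lemma abs_shifted_legendre_le:
  "0 \<le> x \<Longrightarrow> x \<le> 1 \<Longrightarrow> \<bar>shifted_legendre m x\<bar> \<le> sqrt (2 * real m + 1)"
  using abs_legendre_le[of "2 * x - 1" m]
  by (simp add: shifted_legendre_def abs_mult mult_left_le)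

section \<open>Orthogonality and norms\<close>

text \<open>Sturm-Liouville argument: both polynomials are eigenfunctions of one differential
  operator with distinct eigenvalues, and the boundary terms vanish together with
  \<open>1 - x\<^sup>2\<close>.\<close>

lemma legendre_orthogonal:
  assumes "m \<noteq> n"
  shows "((\<lambda>x. legendre m x * legendre n x) has_integral 0) {-1..1}"
proof -
  define F where "F = (\<lambda>x. (1 - x\<^sup>2) * legendre_deriv n x * legendre m x
    - (1 - x\<^sup>2) * legendre_deriv m x * legendre n x)"
  \<comment> \<open>Legendre's differential equation. Expressing the left-hand function through the
    polynomials themselves, as in \<open>eq\<close>, reduces it to a single differentiation.\<close>
  have ode: "((\<lambda>x. (1 - x\<^sup>2) * legendre_deriv k x) has_real_derivative
      - (real k * (real k + 1)) * legendre k x) (at x)" for k x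
  proof (cases k)
    case 0
    then show ?thesis by simp
  next
    case (Suc l)
    have eq: "(1 - x\<^sup>2) * legendre_deriv k x = real k * (legendre l x - x * legendre k x)" for x
    proof -
      have "legendre_deriv l x = x * legendre_deriv k x - real k * legendre k x"
        and "legendre_deriv k x - x * legendre_deriv l x = real k * legendre l x"
        using legendre_deriv_relations[of l x] Suc by (auto simp: algebra_simps)
      then have "legendre_deriv k x - x * (x * legendre_deriv k x - real k * legendre k x)
          = real k * legendre l x"
        by simp
      then show ?thesis
        by (simp add: algebra_simps power2_eq_square)
    qed
    have d: "legendre_deriv l x = x * legendre_deriv k x - real k * legendre k x"
      using legendre_deriv_relations[of l x] Suc by (auto simp: algebra_simps)
    show ?thesis
      unfolding eq
      by (auto intro!: derivative_eq_intros simp: d algebra_simps)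
  qed
  have "(F has_real_derivative
      (real m * (real m + 1) - real n * (real n + 1)) * (legendre m x * legendre n x)) (at x)" for x
    unfolding F_def
    by (rule derivative_eq_intros ode refl)+ (simp add: algebra_simps)
  then have "((\<lambda>x. (real m * (real m + 1) - real n * (real n + 1)) * (legendre m x * legendre n x))
      has_integral F 1 - F (- 1)) {-1..1}"
    by (intro fundamental_theorem_of_calculus)
      (auto simp: has_real_derivative_iff_has_vector_derivative[symmetric]
        intro: has_field_derivative_at_within)
  moreover have "F 1 - F (- 1) = 0"
    by (simp add: F_def)
  moreover have "real m * (real m + 1) - real n * (real n + 1) \<noteq> 0"
  proof -
    have "real m * (real m + 1) - real n * (real n + 1) = (real m - real n) * (real m + real n + 1)"
      by (simp add: algebra_simps)
    then show ?thesis
      using assms by simp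
  qed
  ultimately show ?thesis
    using has_integral_mult_right[of "\<lambda>x. (real m * (real m + 1) - real n * (real n + 1)) *
      (legendre m x * legendre n x)" 0 "{-1..1}"
        "inverse (real m * (real m + 1) - real n * (real n + 1))"]
    by (simp add: mult.assoc[symmetric])
qed

text \<open>The recurrence expresses the integral of \<open>x\<close> times two consecutive
  polynomials through the norm of either one, orthogonality removing the third term. Comparing the
  two expressions gives the ratio of consecutive norms.\<close>

lemma legendre_norm: "((\<lambda>x. (legendre m x)\<^sup>2) has_integral 2 / (2 * real m + 1)) {-1..1}"
proof (induction m)
  case 0
  show ?case using has_integral_const_real[of "1::real" "-1" 1] by simp
next
  case (Suc m)
  define J where "J = (\<lambda>k l. integral {-1..1} (\<lambda>x. legendre k x * legendre l x))"
  have int: "(\<lambda>x. legendre k x * legendre l x) integrable_on {-1..1}" for k l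
    by (intro integrable_continuous_real continuous_intros)
  have J0: "J k l = 0" if "k \<noteq> l" for k l
    using legendre_orthogonal[OF that] by (simp add: J_def integral_unique)
  note rec = legendre_recurrence
  have x1: "(2 * real m + 3) * integral {-1..1} (\<lambda>x. x * (legendre (Suc m) x * legendre m x))
      = (real m + 1) * J m m"
  proof -
    have "(2 * real m + 3) * integral {-1..1} (\<lambda>x. x * (legendre (Suc m) x * legendre m x))
        = integral {-1..1} (\<lambda>x. (real m + 2) * (legendre (Suc (Suc m)) x * legendre m x)
            + (real m + 1) * (legendre m x * legendre m x))"
      unfolding integral_mult_right[symmetric]
    proof (intro integral_cong)
      fix x :: real
      have "(2 * real m + 3) * (x * (legendre (Suc m) x * legendre m x))
          = ((2 * real m + 3) * x * legendre (Suc m) x) * legendre m x"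
        by (simp only: mult.assoc)
      also have "(2 * real m + 3) * x * legendre (Suc m) x
          = (real m + 2) * legendre (Suc (Suc m)) x + (real m + 1) * legendre m x"
        using rec[of m x] by linarith
      finally show "(2 * real m + 3) * (x * (legendre (Suc m) x * legendre m x))
          = (real m + 2) * (legendre (Suc (Suc m)) x * legendre m x)
            + (real m + 1) * (legendre m x * legendre m x)"
        by (simp only: distrib_right mult.assoc)
    qed
    also have "\<dots> = (real m + 2) * J (Suc (Suc m)) m + (real m + 1) * J m m"
      unfolding J_def integral_mult_right[symmetric]
      by (intro integral_add integrable_continuous_real continuous_intros)
    finally show ?thesis by (simp add: J0)
  qed
  have x2: "(real m + 1) * J (Suc m) (Suc m)
      = (2 * real m + 1) * integral {-1..1} (\<lambda>x. x * (legendre (Suc m) x * legendre m x))"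
  proof (cases m)
    case 0
    then show ?thesis by (simp add: J_def)
  next
    case (Suc k)
    have "(real m + 1) * J (Suc m) (Suc m)
        = integral {-1..1} (\<lambda>x. (2 * real m + 1) * (x * (legendre (Suc m) x * legendre m x))
            - real m * (legendre k x * legendre (Suc m) x))"
      unfolding J_def integral_mult_right[symmetric]
    proof (intro integral_cong)
      fix x
      have "(real m + 1) * legendre (Suc m) x = (2 * real m + 1) * x * legendre m x - real m * legendre k x"
        using rec[of k x] Suc by (simp add: algebra_simps)
      then have "(real m + 1) * legendre (Suc m) x * legendre (Suc m) x
          = ((2 * real m + 1) * x * legendre m x - real m * legendre k x) * legendre (Suc m) x"
        by (simp only:)
      then show "(real m + 1) * (legendre (Suc m) x * legendre (Suc m) x)
         = (2 * real m + 1) * (x * (legendre (Suc m) x * legendre m x))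
            - real m * (legendre k x * legendre (Suc m) x)"
        by (simp only: left_diff_distrib right_diff_distrib mult_ac)
    qed
    also have "\<dots> = (2 * real m + 1) * integral {-1..1} (\<lambda>x. x * (legendre (Suc m) x * legendre m x))
        - real m * J k (Suc m)"
      unfolding J_def integral_mult_right[symmetric]
      by (intro integral_diff integrable_continuous_real continuous_intros)
    finally show ?thesis using Suc by (simp add: J0)
  qed
  have Jm: "J m m = 2 / (2 * real m + 1)"
    using Suc by (simp add: J_def power2_eq_square integral_unique)
  have "(2 * real m + 3) * ((real m + 1) * J (Suc m) (Suc m)) = (real m + 1) * 2"
    unfolding x2 using x1 Jm by (simp add: field_simps)
  then have "(real m + 1) * ((2 * real m + 3) * J (Suc m) (Suc m)) = (real m + 1) * 2"
    by (simp only: mult_ac)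
  then have "(2 * real m + 3) * J (Suc m) (Suc m) = 2"
    by (subst (asm) mult_left_cancel) auto
  then have "J (Suc m) (Suc m) = 2 / (2 * real m + 3)"
    by (simp add: eq_divide_eq mult.commute)
  then show ?case
    using integrable_integral[OF int[of "Suc m" "Suc m"]]
    by (simp add: J_def power2_eq_square algebra_simps)
qed

lemma has_integral_legendre_shift:
  assumes "(f has_integral I) {-1..1::real}"
  shows "((\<lambda>x. f (2 * x - 1) :: real) has_integral I / 2) {0..1}"
  using has_integral_affinity'[of f I "-1" 1 2 "-1"] assms by simp

lemma shifted_legendre_orthonormal:
  "((\<lambda>x. shifted_legendre m x * shifted_legendre n x) has_integral (if m = n then 1 else 0)) {0..1}"
proof (cases "m = n")
  case True
  have "((\<lambda>x. (2 * real m + 1) * (legendre m (2 * x - 1))\<^sup>2) has_integral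
      (2 * real m + 1) * ((2 / (2 * real m + 1)) / 2)) {0..1}"
    by (intro has_integral_mult_right has_integral_legendre_shift legendre_norm)
  moreover have "(2 * real m + 1) * ((2 / (2 * real m + 1)) / 2) = 1"
    by simp
  moreover have "(2 * real m + 1) * (legendre m (2 * x - 1))\<^sup>2
      = shifted_legendre m x * shifted_legendre n x" for x
    using True by (simp add: shifted_legendre_def power2_eq_square)
  ultimately show ?thesis
    using True by simp
next
  case False
  have "((\<lambda>x. (sqrt (2 * real m + 1) * sqrt (2 * real n + 1)) *
      (legendre m (2 * x - 1) * legendre n (2 * x - 1))) has_integral
      (sqrt (2 * real m + 1) * sqrt (2 * real n + 1)) * (0 / 2)) {0..1}"
    by (intro has_integral_mult_right has_integral_legendre_shift legendre_orthogonal False)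
  then show ?thesis
    using False by (simp add: shifted_legendre_def mult_ac)
qed

section \<open>Integrals of shifted Legendre polynomials\<close>

text \<open>The chain rule and the recursion for \<open>legendre_deriv\<close> produce
  \<open>2 * (2 * real m + 3)\<close> times the middle polynomial; the denominator leaves exactly
  its normalising factor.\<close>

lemma shifted_legendre_antiderivative:
  "((\<lambda>u. (legendre (Suc (Suc m)) (2 * u - 1) - legendre m (2 * u - 1)) / (2 * sqrt (2 * real m + 3)))
    has_real_derivative shifted_legendre (Suc m) x) (at x)"
proof -
  define w where "w = sqrt (2 * real m + 3)"
  have w: "w > 0" "2 * real m + 3 = w * w" "sqrt (2 * real (Suc m) + 1) = w"
    by (simp_all add: w_def algebra_simps)
  have L: "((\<lambda>u. legendre k (2 * u - 1)) has_real_derivative legendre_deriv k (2 * x - 1) * 2) (at x)" for k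
    by (rule DERIV_chain2[OF has_real_derivative_legendre]) (auto intro!: derivative_eq_intros)
  have eq: "(legendre_deriv (Suc (Suc m)) (2 * x - 1) * 2
      - legendre_deriv m (2 * x - 1) * 2) / (2 * w) = shifted_legendre (Suc m) x"
    unfolding shifted_legendre_def w(3) legendre_deriv.simps w(2)
    using w(1) by (simp add: field_simps)
  show ?thesis
    unfolding eq[symmetric] w_def[symmetric] by (intro DERIV_cdivide DERIV_diff L)
qed

lemma shifted_legendre_integral_Suc:
  assumes "0 \<le> u"
  shows "(shifted_legendre (Suc m) has_integral
    (legendre (Suc (Suc m)) (2 * u - 1) - legendre m (2 * u - 1)) / (2 * sqrt (2 * real m + 3))) {0..u}"
proof -
  define F where "F = (\<lambda>u. (legendre (Suc (Suc m)) (2 * u - 1) - legendre m (2 * u - 1))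
    / (2 * sqrt (2 * real m + 3)))"
  have "(shifted_legendre (Suc m) has_integral F u - F 0) {0..u}"
    using assms shifted_legendre_antiderivative unfolding F_def
    by (intro fundamental_theorem_of_calculus)
      (auto simp: has_real_derivative_iff_has_vector_derivative[symmetric]
        intro: has_field_derivative_at_within)
  \<comment> \<open>Polynomials whose degrees have equal parity agree at -1, so the lower limit
    contributes nothing.\<close>
  moreover have "F 0 = 0"
    by (simp add: F_def legendre_minus_one)
  ultimately show ?thesis
    by (simp add: F_def)
qed

text \<open>A crude bound, equal to the one for \<open>shifted_legendre\<close> itself, so that
  \<open>series_bias\<close> serves both estimators.\<close>

lemma abs_integral_shifted_legendre_le:
  assumes "0 \<le> u" "u \<le> 1"
  shows "\<bar>integral {0..u} (shifted_legendre m)\<bar> \<le> sqrt (2 * real m + 1)"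
proof -
  have "norm (integral (cbox 0 u) (shifted_legendre m)) \<le> sqrt (2 * real m + 1) * measure lborel (cbox 0 u)"
  proof (rule integrable_bound)
    show "shifted_legendre m integrable_on cbox 0 u"
      unfolding cbox_interval by (intro integrable_continuous_real continuous_intros)
    show "norm (shifted_legendre m x) \<le> sqrt (2 * real m + 1)" if "x \<in> cbox 0 u" for x
      using that assms by (simp add: abs_shifted_legendre_le)
  qed simp
  also have "\<dots> \<le> sqrt (2 * real m + 1) * 1"
    using assms by (intro mult_left_mono) auto
  finally show ?thesis by simp
qed

text \<open>The derivative of the sum telescopes.\<close>

lemma sum_integral_shifted_legendre_sq:
  assumes "0 \<le> u"
  shows "((\<lambda>x. 1 + legendre n (2 * x - 1) * legendre (Suc n) (2 * x - 1)) has_integral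
    (\<Sum>m\<le>n. (integral {0..u} (shifted_legendre m))\<^sup>2)) {0..u}"
proof -
  \<comment> \<open>A closed form on the whole line, so that it can be differentiated at every
    point; \<open>m - 1\<close> matters only for positive \<open>m\<close>.\<close>
  define I where "I = (\<lambda>m u. if m = 0 then u else
    (legendre (Suc m) (2 * u - 1) - legendre (m - 1) (2 * u - 1)) / (2 * sqrt (2 * real m + 1)))"
  have I: "(shifted_legendre m has_integral I m u) {0..u}" if "0 \<le> u" for m u
  proof (cases m)
    case 0
    have "((\<lambda>x. 1) has_integral u) {0..u}"
      using has_integral_const_real[of "1::real" 0 u] that by simp
    moreover have "shifted_legendre 0 = (\<lambda>x. 1)"
      by auto
    ultimately show ?thesis
      using 0 by (simp add: I_def)
  next
    case (Suc k)
    then show ?thesis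
      using shifted_legendre_integral_Suc[OF that, of k] by (simp add: I_def algebra_simps)
  qed
  have dI: "(I m has_real_derivative shifted_legendre m x) (at x)" for m x
  proof (cases m)
    case 0
    have "shifted_legendre 0 x = 1" by simp
    moreover have "I 0 = (\<lambda>x. x)" by (auto simp: I_def)
    ultimately show ?thesis
      using 0 by simp
  next
    case (Suc k)
    then show ?thesis
      using shifted_legendre_antiderivative[of k x] by (simp add: I_def algebra_simps)
  qed
  have key: "(\<Sum>m\<le>n. 2 * I m x * shifted_legendre m x)
      = 1 + legendre n (2 * x - 1) * legendre (Suc n) (2 * x - 1)" for x
  proof (induction n)
    case 0
    show ?case by (simp add: I_def)
  next
    case (Suc n)
    have "2 * I (Suc n) x * shifted_legendre (Suc n) x
        = (legendre (Suc (Suc n)) (2 * x - 1) - legendre n (2 * x - 1)) * legendre (Suc n) (2 * x - 1)"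
      by (simp add: I_def shifted_legendre_def)
    then show ?case
      using Suc by (simp add: algebra_simps)
  qed
  have "((\<lambda>u. \<Sum>m\<le>n. (I m u)\<^sup>2) has_real_derivative
      1 + legendre n (2 * x - 1) * legendre (Suc n) (2 * x - 1)) (at x)" for x
    unfolding key[symmetric]
    by (rule derivative_eq_intros dI refl)+ (simp add: mult_ac)
  then have "((\<lambda>x. 1 + legendre n (2 * x - 1) * legendre (Suc n) (2 * x - 1)) has_integral
    (\<Sum>m\<le>n. (I m u)\<^sup>2) - (\<Sum>m\<le>n. (I m 0)\<^sup>2)) {0..u}"
    using assms by (intro fundamental_theorem_of_calculus)
      (auto simp: has_real_derivative_iff_has_vector_derivative[symmetric]
        intro: has_field_derivative_at_within)
  moreover have "I m 0 = 0" for m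
    by (cases m) (auto simp: I_def legendre_minus_one)
  ultimately show ?thesis
    using integral_unique[OF I[OF assms]] by simp
qed

text \<open>Parseval's identity with a rate, \<open>u\<close> being the squared norm of the
  indicator of \<open>{0..u}\<close>. The error is the integral of a product of consecutive
  polynomials, bounded by the arithmetic-geometric mean inequality and their norms.\<close>

lemma sum_integral_shifted_legendre_sq_bound:
  assumes "0 \<le> u" "u \<le> 1"
  shows "\<bar>(\<Sum>m\<le>n. (integral {0..u} (shifted_legendre m))\<^sup>2) - u\<bar> \<le> 1 / (2 * real n + 1)"
proof -
  define g where "g = (\<lambda>x. legendre n (2 * x - 1) * legendre (Suc n) (2 * x - 1))"
  define S where "S = (\<Sum>m\<le>n. (integral {0..u} (shifted_legendre m))\<^sup>2)"
  have g_int: "(\<lambda>x. g x) integrable_on {a..b}" "(\<lambda>x. \<bar>g x\<bar>) integrable_on {a..b}" for a b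
    unfolding g_def by (intro integrable_continuous_real continuous_intros)+
  have "((\<lambda>x. (1 + g x) - 1) has_integral S - u) {0..u}"
    unfolding g_def S_def add.assoc
    using has_integral_diff[OF sum_integral_shifted_legendre_sq[OF assms(1), of n]
        has_integral_const_real[of "1::real" 0 u]] assms by simp
  then have "S - u = integral {0..u} g"
    by (simp add: integral_unique)
  also have "\<bar>integral {0..u} g\<bar> \<le> integral {0..u} (\<lambda>x. \<bar>g x\<bar>)"
    using integral_norm_bound_integral[of g "{0..u}" "\<lambda>x. \<bar>g x\<bar>"] g_int by simp
  also have "\<dots> \<le> integral {0..1} (\<lambda>x. \<bar>g x\<bar>)"
    using assms by (intro integral_subset_le g_int) auto
  also have "\<dots> \<le> integral {0..1} (\<lambda>x. ((legendre n (2 * x - 1))\<^sup>2 + (legendre (Suc n) (2 * x - 1))\<^sup>2) / 2)"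
  proof (intro integral_le g_int)
    show "(\<lambda>x. ((legendre n (2 * x - 1))\<^sup>2 + (legendre (Suc n) (2 * x - 1))\<^sup>2) / 2) integrable_on {0..1}"
      by (intro integrable_continuous_real continuous_intros) auto
    show "\<bar>g x\<bar> \<le> ((legendre n (2 * x - 1))\<^sup>2 + (legendre (Suc n) (2 * x - 1))\<^sup>2) / 2" for x
      using sum_squares_bound[of "\<bar>legendre n (2 * x - 1)\<bar>" "\<bar>legendre (Suc n) (2 * x - 1)\<bar>"]
      by (simp add: g_def abs_mult)
  qed
  also have "\<dots> = (2 / (2 * real n + 1) / 2 + 2 / (2 * real (Suc n) + 1) / 2) / 2"
    by (intro integral_unique has_integral_divide has_integral_add
        has_integral_legendre_shift[OF legendre_norm])
  also have "\<dots> \<le> 1 / (2 * real n + 1)"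
  proof -
    have "1 / (2 * real (Suc n) + 1) \<le> 1 / (2 * real n + 1)"
      by (intro divide_left_mono) auto
    moreover have "2 / t / 2 = 1 / t" for t :: real
      by simp
    ultimately show ?thesis
      by (simp only:) simp
  qed
  finally show ?thesis
    by (simp add: S_def)
qed


section \<open>Lipschitz and Taylor estimates for the shifted polynomials\<close>

lemma legendre_shift_lipschitz:
  assumes "x \<in> {0..1}" "y \<in> {0..1}"
  shows "\<bar>legendre m (2 * y - 1) - legendre m (2 * x - 1)\<bar> \<le> real m * (real m + 1) * \<bar>y - x\<bar>"
proof -
  have "norm (legendre m (2 * y - 1) - legendre m (2 * x - 1))
      \<le> real m * (real m + 1) / 2 * norm ((2 * y - 1) - (2 * x - 1))"
  proof (rule field_differentiable_bound[where S="{-1..1}"])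
    show "convex {-1..1::real}" by simp
    show "(legendre m has_field_derivative legendre_deriv m z) (at z within {-1..1})" for z
      by (rule has_field_derivative_at_within[OF has_real_derivative_legendre])
    show "norm (legendre_deriv m z) \<le> real m * (real m + 1) / 2" if "z \<in> {-1..1}" for z
      using abs_legendre_deriv_le[of z m] that by auto
  qed (use assms in auto)
  moreover have "(2 * y - 1) - (2 * x - 1) = 2 * (y - x)"
    by simp
  ultimately show ?thesis
    by (simp only: real_norm_def abs_mult) simp
qed

text \<open>The factor 4 from the substitution cancels the 4 in the bound on the second derivative,
  so the error is the square of the Lipschitz bound.\<close>

lemma legendre_shift_taylor:
  assumes "x \<in> {0..1}" "y \<in> {0..1}"
  shows "\<bar>legendre m (2 * y - 1) - legendre m (2 * x - 1) - 2 * legendre_deriv m (2 * x - 1) * (y - x)\<bar>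
    \<le> (real m * (real m + 1) * \<bar>y - x\<bar>)\<^sup>2"
proof -
  define f where "f = (\<lambda>i::nat. if i = 0 then legendre m else if i = 1 then legendre_deriv m else legendre_deriv2 m)"
  \<comment> \<open>The remainder in \<open>field_Taylor\<close> is divided by \<open>fact 1\<close>
    instead of \<open>fact 2\<close>, so no factor 1/2 is gained.\<close>
  have "norm (f 0 (2 * y - 1) - (\<Sum>i\<le>1. f i (2 * x - 1) * ((2 * y - 1) - (2 * x - 1)) ^ i / fact i))
    \<le> (real m * (real m + 1))\<^sup>2 / 4 * norm ((2 * y - 1) - (2 * x - 1)) ^ Suc 1 / fact 1"
  proof (rule field_Taylor[where S="{-1..1}"])
    show "convex {-1..1::real}" by simp
    show "(f i has_field_derivative f (Suc i) z) (at z within {-1..1})" if "i \<le> 1" for i z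
      using that by (cases i) (auto simp: f_def has_field_derivative_at_within
        has_real_derivative_legendre has_real_derivative_legendre_deriv)
    show "norm (f (Suc 1) z) \<le> (real m * (real m + 1))\<^sup>2 / 4" if "z \<in> {-1..1}" for z
      using abs_legendre_deriv2_le[of z m] that by (auto simp: f_def)
  qed (use assms in auto)
  moreover have "(2 * y - 1) - (2 * x - 1) = 2 * (y - x)"
    by simp
  moreover have "(\<Sum>i\<le>1. f i (2 * x - 1) * (2 * (y - x)) ^ i / fact i)
      = legendre m (2 * x - 1) + 2 * legendre_deriv m (2 * x - 1) * (y - x)"
    by (simp add: f_def)
  moreover have "f 0 = legendre m"
    by (simp add: f_def)
  ultimately have "\<bar>legendre m (2 * y - 1) - (legendre m (2 * x - 1) + 2 * legendre_deriv m (2 * x - 1) * (y - x))\<bar>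
    \<le> (real m * (real m + 1))\<^sup>2 / 4 * \<bar>2 * (y - x)\<bar>\<^sup>2"
    by (simp only: real_norm_def fact_1 div_by_1 Suc_1)
  also have "\<dots> = (real m * (real m + 1) * \<bar>y - x\<bar>)\<^sup>2"
    by (simp only: abs_mult power_mult_distrib) simp
  finally show ?thesis
    by (simp only: diff_diff_eq)
qed

section \<open>Bias of the empirical coefficients\<close>

text \<open>Here \<open>r\<close> is the linear part of \<open>q - p\<close>. Both bounds are proved
  together, because a new factor produces the mixed term \<open>(q k - p k) * (Q - P)\<close>; the
  first bound makes it at most \<open>\<delta> k * S\<close>, which the square of the sum
  absorbs.\<close>

lemma prod_taylor:
  fixes p q r \<delta> :: "'i \<Rightarrow> real"
  assumes "finite J"
    and "\<And>j. j \<in> J \<Longrightarrow> \<bar>p j\<bar> \<le> 1" "\<And>j. j \<in> J \<Longrightarrow> \<bar>q j\<bar> \<le> 1"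
    and "\<And>j. j \<in> J \<Longrightarrow> \<bar>q j - p j\<bar> \<le> \<delta> j" "\<And>j. j \<in> J \<Longrightarrow> \<bar>q j - p j - r j\<bar> \<le> (\<delta> j)\<^sup>2"
  shows "\<bar>(\<Prod>j\<in>J. q j) - (\<Prod>j\<in>J. p j)\<bar> \<le> (\<Sum>j\<in>J. \<delta> j) \<and>
    \<bar>(\<Prod>j\<in>J. q j) - (\<Prod>j\<in>J. p j) - (\<Sum>j\<in>J. r j * (\<Prod>i\<in>J - {j}. p i))\<bar> \<le> (\<Sum>j\<in>J. \<delta> j)\<^sup>2"
  using assms
proof (induction J rule: finite_induct)
  case (insert k J)
  define P Q S R where "P = (\<Prod>j\<in>J. p j)" and "Q = (\<Prod>j\<in>J. q j)" and "S = (\<Sum>j\<in>J. \<delta> j)"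
    and "R = (\<Sum>j\<in>J. r j * (\<Prod>i\<in>J - {j}. p i))"
  have IH: "\<bar>Q - P\<bar> \<le> S" "\<bar>Q - P - R\<bar> \<le> S\<^sup>2"
    using insert.IH insert.prems by (auto simp: P_def Q_def S_def R_def)
  have k: "\<bar>p k\<bar> \<le> 1" "\<bar>q k\<bar> \<le> 1" "\<bar>q k - p k\<bar> \<le> \<delta> k" "\<bar>q k - p k - r k\<bar> \<le> (\<delta> k)\<^sup>2"
    using insert.prems by auto
  have P: "\<bar>P\<bar> \<le> 1" and Q: "\<bar>Q\<bar> \<le> 1"
    using insert.prems by (auto simp: P_def Q_def abs_prod intro!: prod_le_1)
  have pos: "S \<ge> 0" "\<delta> k \<ge> 0"
    using IH(1) k(3) by linarith+
  have R: "(\<Sum>j\<in>insert k J. r j * (\<Prod>i\<in>insert k J - {j}. p i)) = r k * P + p k * R"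
  proof -
    have "(\<Sum>j\<in>J. r j * (\<Prod>i\<in>insert k J - {j}. p i)) = (\<Sum>j\<in>J. p k * (r j * (\<Prod>i\<in>J - {j}. p i)))"
    proof (rule sum.cong[OF refl])
      fix j assume j: "j \<in> J"
      then have "insert k J - {j} = insert k (J - {j})"
        using insert.hyps by auto
      then show "r j * (\<Prod>i\<in>insert k J - {j}. p i) = p k * (r j * (\<Prod>i\<in>J - {j}. p i))"
        using insert.hyps by simp
    qed
    moreover have "insert k J - {k} = J"
      using insert.hyps by auto
    ultimately show ?thesis
      using insert.hyps by (simp add: R_def P_def sum_distrib_left)
  qed
  have 1: "\<bar>q k * Q - p k * P\<bar> \<le> \<delta> k + S"
  proof -
    have "q k * Q - p k * P = (q k - p k) * Q + p k * (Q - P)"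
      by (simp add: algebra_simps)
    also have "\<bar>\<dots>\<bar> \<le> \<bar>q k - p k\<bar> * \<bar>Q\<bar> + \<bar>p k\<bar> * \<bar>Q - P\<bar>"
      by (metis abs_mult abs_triangle_ineq)
    also have "\<dots> \<le> \<delta> k * 1 + 1 * S"
      by (intro add_mono mult_mono k Q IH pos) simp_all
    finally show ?thesis by simp
  qed
  have 2: "\<bar>q k * Q - p k * P - (r k * P + p k * R)\<bar> \<le> (\<delta> k + S)\<^sup>2"
  proof -
    have "q k * Q - p k * P - (r k * P + p k * R)
        = p k * (Q - P - R) + ((q k - p k - r k) * P + (q k - p k) * (Q - P))"
      by (simp add: algebra_simps)
    also have "\<bar>\<dots>\<bar> \<le> \<bar>p k\<bar> * \<bar>Q - P - R\<bar> + (\<bar>q k - p k - r k\<bar> * \<bar>P\<bar> + \<bar>q k - p k\<bar> * \<bar>Q - P\<bar>)"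
      by (intro order.trans[OF abs_triangle_ineq] add_mono) (simp_all add: abs_mult)
    also have "\<dots> \<le> 1 * S\<^sup>2 + ((\<delta> k)\<^sup>2 * 1 + \<delta> k * S)"
      by (intro add_mono mult_mono k P IH pos) simp_all
    also have "\<dots> \<le> (\<delta> k + S)\<^sup>2"
      using pos by (simp add: power2_sum)
    finally show ?thesis .
  qed
  show ?case
    unfolding R using 1 2 insert.hyps by (simp add: P_def Q_def S_def)
qed simp

lemma borel_measurable_vec_nth_comp [measurable (raw)]:
  "f \<in> borel_measurable M \<Longrightarrow> (\<lambda>x. (f x :: real ^ 'd) $ j) \<in> borel_measurable M"
  by (rule borel_measurable_continuous_on[OF linear_continuous_on[OF bounded_linear_vec_nth]])

section \<open>Empirical distribution functions of an i.i.d. sample\<close>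

locale iid_sample = prob_space M for M :: "'a measure" +
  fixes X :: "nat \<Rightarrow> 'a \<Rightarrow> real ^ 'd"
  assumes indep: "indep_vars (\<lambda>_. borel) X UNIV"
    and ident: "\<And>i. distr M borel (X i) = distr M borel (X 0)"
begin

abbreviation F :: "'d \<Rightarrow> real \<Rightarrow> real" where
  "F \<equiv> marginal_cdf M (X 0)"

text \<open>The centring makes the integral over \<open>y\<close> vanish for every fixed
  \<open>x\<close>. The error of the empirical distribution function at \<open>X i\<close> is the
  average of these terms over the sample.\<close>

definition \<xi> :: "'d \<Rightarrow> real ^ 'd \<Rightarrow> real ^ 'd \<Rightarrow> real" where
  "\<xi> j x y = (if y $ j \<le> x $ j then 1 else 0) - F j (x $ j)"

lemma measurable_sample [measurable]: "X i \<in> borel_measurable M"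
  using indep by (auto simp: indep_vars_def2)

lemma real_distribution_marginal: "real_distribution (distr M borel (\<lambda>\<omega>. X i \<omega> $ j))"
  by (intro real_distribution_distr) simp

lemma F_bounds: "0 \<le> F j x" "F j x \<le> 1"
proof -
  interpret R: real_distribution "distr M borel (\<lambda>\<omega>. X 0 \<omega> $ j)"
    by (rule real_distribution_marginal)
  show "0 \<le> F j x" "F j x \<le> 1"
    unfolding marginal_cdf_def using R.cdf_nonneg R.cdf_bounded_prob by auto
qed

lemma measurable_F [measurable]: "F j \<in> borel_measurable borel"
proof -
  interpret R: real_distribution "distr M borel (\<lambda>\<omega>. X 0 \<omega> $ j)"
    by (rule real_distribution_marginal)
  show ?thesis
    unfolding marginal_cdf_def by (intro borel_measurable_mono monoI R.cdf_nondecreasing)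
qed

lemma measurable_F_comp [measurable (raw)]:
  "f \<in> borel_measurable N \<Longrightarrow> (\<lambda>x. F j (f x)) \<in> borel_measurable N"
  by (rule measurable_compose[OF _ measurable_F])

lemma measurable_\<xi> [measurable (raw)]:
  assumes [measurable]: "f \<in> borel_measurable N" "g \<in> borel_measurable N"
  shows "(\<lambda>x. \<xi> j (f x) (g x)) \<in> borel_measurable N"
  unfolding \<xi>_def by measurable

lemma abs_\<xi>_le: "\<bar>\<xi> j x y\<bar> \<le> 1"
  using F_bounds[of j "x $ j"] by (auto simp: \<xi>_def)

lemma integral_\<xi>: "(LINT y|distr M borel (X k). \<xi> j x y) = 0"
proof -
  have "(LINT y|distr M borel (X k). \<xi> j x y) = expectation (\<lambda>\<omega>. \<xi> j x (X 0 \<omega>))"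
    unfolding ident[of k] by (subst integral_distr) auto
  also have "\<dots> = expectation (\<lambda>\<omega>. indicator {\<omega> \<in> space M. X 0 \<omega> $ j \<le> x $ j} \<omega> - F j (x $ j))"
    by (intro Bochner_Integration.integral_cong) (auto simp: \<xi>_def)
  also have "\<dots> = prob {\<omega> \<in> space M. X 0 \<omega> $ j \<le> x $ j} - F j (x $ j)"
    by (subst Bochner_Integration.integral_diff)
      (auto simp: prob_space intro!: integrable_const_bound[where B=1])
  also have "\<dots> = 0"
    by (simp add: marginal_cdf_def cdf_def measure_distr vimage_def Int_def conj_commute)
  finally show ?thesis .
qed

text \<open>\<open>X k\<close> is independent of the pair of \<open>X i\<close> and
  \<open>X l\<close>, so Fubini integrates it out first, where \<open>\<xi>\<close> has mean zero.
  The case \<open>i = l\<close> is allowed and covers factors depending on \<open>X i\<close>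
  alone.\<close>

lemma expectation_mult_\<xi>:
  assumes [measurable]: "\<psi> \<in> borel_measurable (borel \<Otimes>\<^sub>M borel)"
    and bound: "\<And>x. \<bar>\<psi> x\<bar> \<le> B"
    and "k \<noteq> i" "k \<noteq> l"
  shows "expectation (\<lambda>\<omega>. \<psi> (X i \<omega>, X l \<omega>) * \<xi> j (X i \<omega>) (X k \<omega>)) = 0"
proof -
  \<comment> \<open>Independence of blocks is stated for restrictions of the family to disjoint
    index sets, hence product spaces instead of pairs.\<close>
  let ?S = "PiM {i, l} (\<lambda>_. borel)" and ?T = "PiM {k} (\<lambda>_. borel)"
  let ?P = "\<lambda>\<omega>. restrict (\<lambda>i. X i \<omega>) {i, l}" and ?Y = "\<lambda>\<omega>. restrict (\<lambda>i. X i \<omega>) {k}"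
  let ?h = "\<lambda>z. \<psi> (fst z i, fst z l) * \<xi> j (fst z i) (snd z k)"
  have [measurable]: "?P \<in> measurable M ?S" "?Y \<in> measurable M ?T"
    by (auto intro!: measurable_restrict)
  have comp [measurable]: "(\<lambda>z. fst z i) \<in> borel_measurable (?S \<Otimes>\<^sub>M ?T)"
      "(\<lambda>z. fst z l) \<in> borel_measurable (?S \<Otimes>\<^sub>M ?T)" "(\<lambda>z. snd z k) \<in> borel_measurable (?S \<Otimes>\<^sub>M ?T)"
    by measurable
  have h [measurable]: "?h \<in> borel_measurable (?S \<Otimes>\<^sub>M ?T)"
    by measurable
  have "indep_var ?S ?P ?T ?Y"
    using assms by (intro indep_var_restrict[OF indep]) auto
  then have joint: "distr M ?S ?P \<Otimes>\<^sub>M distr M ?T ?Y = distr M (?S \<Otimes>\<^sub>M ?T) (\<lambda>\<omega>. (?P \<omega>, ?Y \<omega>))"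
    by (simp add: indep_var_distribution_eq)
  interpret P: prob_space "distr M ?S ?P"
    by (intro prob_space_distr) measurable
  interpret Y: prob_space "distr M ?T ?Y"
    by (intro prob_space_distr) measurable
  interpret PY: pair_prob_space "distr M ?S ?P" "distr M ?T ?Y" ..
  have int: "integrable (distr M ?S ?P \<Otimes>\<^sub>M distr M ?T ?Y) ?h"
  proof (rule PY.P.integrable_const_bound[where B=B])
    have "\<bar>\<psi> x * \<xi> j y z\<bar> \<le> B" for x y z
      using mult_mono[OF bound[of x] abs_\<xi>_le[of j y z]] order.trans[OF abs_ge_zero bound[of x]]
      by (simp add: abs_mult)
    then show "AE z in distr M ?S ?P \<Otimes>\<^sub>M distr M ?T ?Y. norm (?h z) \<le> B"
      by simp
  qed (use h in simp)
  have inner: "(LINT y|distr M ?T ?Y. \<xi> j x (y k)) = 0" for x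
  proof -
    have "(LINT y|distr M ?T ?Y. \<xi> j x (y k)) = expectation (\<lambda>\<omega>. \<xi> j x (X k \<omega>))"
      by (subst integral_distr) auto
    also have "\<dots> = (LINT y|distr M borel (X k). \<xi> j x y)"
      by (subst integral_distr) auto
    finally show ?thesis by (simp add: integral_\<xi>)
  qed
  have "expectation (\<lambda>\<omega>. ?h (?P \<omega>, ?Y \<omega>)) = (LINT z|distr M (?S \<Otimes>\<^sub>M ?T) (\<lambda>\<omega>. (?P \<omega>, ?Y \<omega>)). ?h z)"
    by (subst integral_distr) auto
  also have "\<dots> = (LINT x|distr M ?S ?P. LINT y|distr M ?T ?Y. ?h (x, y))"
    unfolding joint[symmetric] using int by (rule PY.integral_fst'[symmetric])
  also have "\<dots> = 0"
    by (simp add: inner)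
  finally show ?thesis by simp
qed

definition \<Delta> :: "nat \<Rightarrow> nat \<Rightarrow> 'd \<Rightarrow> 'a \<Rightarrow> real" where
  "\<Delta> n i j \<omega> = emp_cdf X n \<omega> j (X i \<omega> $ j) - F j (X i \<omega> $ j)"

lemma \<Delta>_eq:
  assumes "n > 0"
  shows "\<Delta> n i j \<omega> = (\<Sum>k<n. \<xi> j (X i \<omega>) (X k \<omega>)) / n"
proof -
  have "indicator {..x} y = (if y \<le> x then 1 else 0 :: real)" for x y :: real
    by simp
  then show ?thesis
    using assms by (simp only: \<Delta>_def emp_cdf_def \<xi>_def sum_subtractf diff_divide_distrib) simp
qed

lemma measurable_emp_cdf [measurable]: "(\<lambda>\<omega>. emp_cdf X n \<omega> j (X i \<omega> $ j)) \<in> borel_measurable M"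
  unfolding emp_cdf_def indicator_def atMost_iff of_bool_def by measurable

lemma measurable_\<Delta> [measurable]: "\<Delta> n i j \<in> borel_measurable M"
  unfolding \<Delta>_def by measurable

lemma emp_cdf_bounds: "0 \<le> emp_cdf X n \<omega> j x" "emp_cdf X n \<omega> j x \<le> 1"
proof -
  have "(\<Sum>i<n. indicator {..x} (X i \<omega> $ j) :: real) \<le> (\<Sum>i<n. 1)"
    by (intro sum_mono) (auto simp: indicator_def)
  then show "0 \<le> emp_cdf X n \<omega> j x" "emp_cdf X n \<omega> j x \<le> 1"
    by (auto simp: emp_cdf_def divide_le_eq_1 intro!: divide_nonneg_nonneg sum_nonneg)
qed

lemma abs_\<Delta>_le: "\<bar>\<Delta> n i j \<omega>\<bar> \<le> 1"
  using F_bounds[of j "X i \<omega> $ j"] emp_cdf_bounds[of n \<omega> j "X i \<omega> $ j"] by (auto simp: \<Delta>_def)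

text \<open>\<open>\<Delta>\<close> averages \<open>n\<close> terms, and those from other
  observations contribute mean zero. The single term comparing \<open>X i\<close> with itself
  contributes at most \<open>B\<close> before the division by \<open>n\<close>.\<close>

lemma abs_expectation_mult_\<Delta>_le:
  assumes [measurable]: "\<phi> \<in> borel_measurable borel"
    and bound: "\<And>x. \<bar>\<phi> x\<bar> \<le> B" and i: "i < n"
  shows "\<bar>expectation (\<lambda>\<omega>. \<phi> (X i \<omega>) * \<Delta> n i j \<omega>)\<bar> \<le> B / n"
proof -
  have B: "B \<ge> 0"
    using bound[of 0] by linarith
  have b: "\<bar>\<phi> x * \<xi> j x y\<bar> \<le> B" for x y
    using mult_mono[OF bound[of x] abs_\<xi>_le[of j x y]] B by (simp add: abs_mult)
  have int: "integrable M (\<lambda>\<omega>. \<phi> (X i \<omega>) * \<xi> j (X i \<omega>) (X k \<omega>))" for k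
    by (rule integrable_const_bound[where B=B]) (use b in auto)
  have zero: "expectation (\<lambda>\<omega>. \<phi> (X i \<omega>) * \<xi> j (X i \<omega>) (X k \<omega>)) = 0" if "k \<noteq> i" for k
    using expectation_mult_\<xi>[of "\<lambda>x. \<phi> (fst x)" B k i i j] bound that by simp
  have "expectation (\<lambda>\<omega>. \<phi> (X i \<omega>) * \<Delta> n i j \<omega>)
      = expectation (\<lambda>\<omega>. (\<Sum>k<n. \<phi> (X i \<omega>) * \<xi> j (X i \<omega>) (X k \<omega>)) / n)"
    using i by (simp add: \<Delta>_eq sum_distrib_left)
  also have "\<dots> = (\<Sum>k<n. expectation (\<lambda>\<omega>. \<phi> (X i \<omega>) * \<xi> j (X i \<omega>) (X k \<omega>))) / n"
    using int by simp
  also have "\<dots> = expectation (\<lambda>\<omega>. \<phi> (X i \<omega>) * \<xi> j (X i \<omega>) (X i \<omega>)) / n"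
    using i zero by (subst sum.remove[of _ i]) auto
  also have "\<bar>\<dots>\<bar> \<le> B / n"
  proof -
    have "\<bar>expectation (\<lambda>\<omega>. \<phi> (X i \<omega>) * \<xi> j (X i \<omega>) (X i \<omega>))\<bar>
        \<le> expectation (\<lambda>\<omega>. \<bar>\<phi> (X i \<omega>) * \<xi> j (X i \<omega>) (X i \<omega>)\<bar>)"
      by (rule integral_abs_bound)
    also have "\<dots> \<le> expectation (\<lambda>_. B)"
      by (intro integral_mono integrable_abs int b) auto
    finally show ?thesis
      by (simp add: divide_right_mono prob_space)
  qed
  finally show ?thesis .
qed

text \<open>Expanded as a double sum over the sample, the square has mean zero off the diagonal,
  while each of the \<open>n\<close> diagonal terms is at most 1.\<close>

lemma expectation_\<Delta>_sq_le:
  assumes i: "i < n"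
  shows "expectation (\<lambda>\<omega>. (\<Delta> n i j \<omega>)\<^sup>2) \<le> 1 / n"
proof -
  let ?e = "\<lambda>k l. expectation (\<lambda>\<omega>. \<xi> j (X i \<omega>) (X k \<omega>) * \<xi> j (X i \<omega>) (X l \<omega>))"
  have b: "\<bar>\<xi> j x y * \<xi> j x z\<bar> \<le> 1" for x y z
    using mult_mono[OF abs_\<xi>_le[of j x y] abs_\<xi>_le[of j x z]] by (simp add: abs_mult)
  have int: "integrable M (\<lambda>\<omega>. \<xi> j (X i \<omega>) (X k \<omega>) * \<xi> j (X i \<omega>) (X l \<omega>))" for k l
    by (rule integrable_const_bound[where B=1]) (use b in auto)
  have zero: "?e k l = 0" if "k \<noteq> i" "k \<noteq> l" for k l
    using expectation_mult_\<xi>[of "\<lambda>x. \<xi> j (fst x) (snd x)" 1 k i l j] abs_\<xi>_le that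
    by (simp add: mult.commute)
  have e: "?e k l \<le> (if k = l then 1 else 0)" for k l
  proof (cases "k = l")
    case True
    have "?e k l \<le> expectation (\<lambda>_. 1)"
      by (intro integral_mono int) (use abs_le_D1[OF b] in auto)
    then show ?thesis
      using True by (simp add: prob_space)
  next
    case False
    \<comment> \<open>Two different indices cannot both equal \<open>i\<close>; one that differs
      from \<open>i\<close> is integrated out.\<close>
    then show ?thesis
      using zero[of k l] zero[of l k] by (cases "k = i") (auto simp: mult.commute)
  qed
  have "expectation (\<lambda>\<omega>. (\<Delta> n i j \<omega>)\<^sup>2)
      = expectation (\<lambda>\<omega>. (\<Sum>k<n. \<Sum>l<n. \<xi> j (X i \<omega>) (X k \<omega>) * \<xi> j (X i \<omega>) (X l \<omega>)) / (real n)\<^sup>2)"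
    using i by (simp add: \<Delta>_eq power_divide power2_eq_square[of "sum _ _"] sum_product)
  also have "\<dots> = (\<Sum>k<n. \<Sum>l<n. ?e k l) / (real n)\<^sup>2"
    using int by simp
  also have "\<dots> \<le> (\<Sum>k<n. \<Sum>l<n. if k = l then 1 else 0) / (real n)\<^sup>2"
    by (intro divide_right_mono sum_mono e) auto
  also have "\<dots> = 1 / n"
    by (simp add: power2_eq_square)
  finally show ?thesis .
qed

text \<open>The first-order Taylor term is the only one that could be as large as \<open>n\<close> to the power
  \<open>-1/2\<close>; by independence only the summand with index \<open>i\<close> of the empirical distribution function
  contributes to its mean.\<close>

lemma empirical_legendre_bias:
  assumes i: "i < n" and K: "\<And>j. m j * (m j + 1) \<le> K"
  shows "\<bar>expectation (\<lambda>\<omega>. \<Prod>j\<in>UNIV. legendre (m j) (2 * emp_cdf X n \<omega> j (X i \<omega> $ j) - 1))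
      - expectation (\<lambda>\<omega>. \<Prod>j\<in>UNIV. legendre (m j) (2 * F j (X 0 \<omega> $ j) - 1))\<bar>
    \<le> 2 * (real CARD('d))\<^sup>2 * (real K)\<^sup>2 / n"
proof -
  define l where "l = (\<lambda>j. real (m j) * (real (m j) + 1))"
  define p where "p = (\<lambda>j \<omega>. legendre (m j) (2 * F j (X i \<omega> $ j) - 1))"
  define q where "q = (\<lambda>j \<omega>. legendre (m j) (2 * emp_cdf X n \<omega> j (X i \<omega> $ j) - 1))"
  \<comment> \<open>The partial derivative of the product with respect to the rank in coordinate
    \<open>j\<close>, at the exact ranks; the 2 comes from the shifted argument.\<close>
  define \<phi> where "\<phi> = (\<lambda>j x. 2 * legendre_deriv (m j) (2 * F j (x $ j) - 1)
    * (\<Prod>k\<in>UNIV - {j}. legendre (m k) (2 * F k (x $ k) - 1)))"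
  define R where "R = (\<lambda>\<omega>. (\<Prod>j\<in>UNIV. q j \<omega>) - (\<Prod>j\<in>UNIV. p j \<omega>) - (\<Sum>j\<in>UNIV. \<phi> j (X i \<omega>) * \<Delta> n i j \<omega>))"
  have [measurable]: "legendre k \<in> borel_measurable borel" for k
    by (intro borel_measurable_continuous_onI continuous_intros)
  have [measurable]: "legendre_deriv k \<in> borel_measurable borel" for k
    by (intro borel_measurable_continuous_onI continuous_at_imp_continuous_on ballI)
      (rule DERIV_isCont[OF has_real_derivative_legendre_deriv])
  have [measurable]: "p j \<in> borel_measurable M" "q j \<in> borel_measurable M"
    "\<phi> j \<in> borel_measurable borel" for j
    unfolding p_def q_def \<phi>_def by measurable
  have l: "0 \<le> l j" "l j \<le> (real K)\<^sup>2" "(l j)\<^sup>2 \<le> (real K)\<^sup>2" for j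
  proof -
    have "l j = real (m j * (m j + 1))"
      by (simp add: l_def algebra_simps)
    then have 1: "l j \<le> real K"
      using K[of j] by (simp only: of_nat_le_iff)
    show "0 \<le> l j"
      by (simp add: l_def)
    then show "(l j)\<^sup>2 \<le> (real K)\<^sup>2"
      using 1 by (intro power_mono)
    \<comment> \<open>True because \<open>K\<close> is a natural number; it lets the linear and the
      quadratic term share one bound.\<close>
    have "real K \<le> (real K)\<^sup>2"
      by (metis le_square of_nat_le_iff of_nat_mult power2_eq_square)
    then show "l j \<le> (real K)\<^sup>2"
      using 1 by (rule order.trans[rotated])
  qed
  have L1: "\<bar>legendre k (2 * F j x - 1)\<bar> \<le> 1" for k j x
    using F_bounds[of j x] by (intro abs_legendre_le) auto
  have pq: "\<bar>p j \<omega>\<bar> \<le> 1" "\<bar>q j \<omega>\<bar> \<le> 1" for j \<omega>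
    unfolding p_def q_def using emp_cdf_bounds[of n \<omega> j "X i \<omega> $ j"] F_bounds[of j "X i \<omega> $ j"]
    by (auto intro!: abs_legendre_le)
  have prod1: "\<bar>\<Prod>j\<in>J. f j\<bar> \<le> 1" if "\<And>j. \<bar>f j\<bar> \<le> 1" for f :: "'d \<Rightarrow> real" and J
    using that by (auto simp: abs_prod intro!: prod_le_1)
  have \<phi>_bound: "\<bar>\<phi> j x\<bar> \<le> l j" for j x
  proof -
    have "\<bar>\<phi> j x\<bar> = 2 * \<bar>legendre_deriv (m j) (2 * F j (x $ j) - 1)\<bar>
        * \<bar>\<Prod>k\<in>UNIV - {j}. legendre (m k) (2 * F k (x $ k) - 1)\<bar>"
      by (simp add: \<phi>_def abs_mult)
    also have "\<dots> \<le> 2 * (l j / 2) * 1"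
      unfolding l_def using F_bounds[of j "x $ j"]
      by (intro mult_mono prod1 L1 abs_legendre_deriv_le) auto
    finally show ?thesis by simp
  qed
  have R_bound: "\<bar>R \<omega>\<bar> \<le> real CARD('d) * (\<Sum>j\<in>UNIV. (real K)\<^sup>2 * (\<Delta> n i j \<omega>)\<^sup>2)" for \<omega>
  proof -
    have U: "F j (X i \<omega> $ j) \<in> {0..1}" "emp_cdf X n \<omega> j (X i \<omega> $ j) \<in> {0..1}" for j
      using F_bounds emp_cdf_bounds by auto
    have "\<bar>R \<omega>\<bar> = \<bar>(\<Prod>j\<in>UNIV. q j \<omega>) - (\<Prod>j\<in>UNIV. p j \<omega>) - (\<Sum>j\<in>UNIV.
        (2 * legendre_deriv (m j) (2 * F j (X i \<omega> $ j) - 1) * \<Delta> n i j \<omega>) * (\<Prod>k\<in>UNIV - {j}. p k \<omega>))\<bar>"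
      by (simp add: R_def \<phi>_def p_def mult_ac)
    also have "\<dots> \<le> (\<Sum>j\<in>UNIV. l j * \<bar>\<Delta> n i j \<omega>\<bar>)\<^sup>2"
      using legendre_shift_lipschitz[OF U(1) U(2)] legendre_shift_taylor[OF U(1) U(2)]
      by (intro prod_taylor[THEN conjunct2] pq) (auto simp: p_def q_def l_def \<Delta>_def)
    \<comment> \<open>Cauchy-Schwarz separates the coordinates, so that the variance bound applies
      to each of them.\<close>
    also have "\<dots> \<le> real CARD('d) * (\<Sum>j\<in>UNIV. (l j * \<bar>\<Delta> n i j \<omega>\<bar>)\<^sup>2)"
      using sum_squared_le_sum_of_squares[of "\<lambda>j. l j * \<bar>\<Delta> n i j \<omega>\<bar>" "UNIV :: 'd set"]
      by (simp add: mult.commute)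
    also have "\<dots> \<le> real CARD('d) * (\<Sum>j\<in>UNIV. (real K)\<^sup>2 * (\<Delta> n i j \<omega>)\<^sup>2)"
      using l by (intro mult_left_mono sum_mono) (auto simp: power_mult_distrib intro!: mult_right_mono)
    finally show ?thesis .
  qed
  have int_\<Delta>: "integrable M (\<lambda>\<omega>. (\<Delta> n i j \<omega>)\<^sup>2)" for j
    by (rule integrable_const_bound[where B=1]) (auto simp: abs_square_le_1 abs_\<Delta>_le)
  have int_p: "integrable M (\<lambda>\<omega>. \<Prod>j\<in>UNIV. p j \<omega>)" and int_q: "integrable M (\<lambda>\<omega>. \<Prod>j\<in>UNIV. q j \<omega>)"
    by (auto intro!: integrable_const_bound[where B=1] prod1 pq)
  have int_\<phi>: "integrable M (\<lambda>\<omega>. \<phi> j (X i \<omega>) * \<Delta> n i j \<omega>)" for j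
  proof (rule integrable_const_bound[where B="l j"])
    show "AE \<omega> in M. norm (\<phi> j (X i \<omega>) * \<Delta> n i j \<omega>) \<le> l j"
      using mult_mono[OF \<phi>_bound abs_\<Delta>_le l(1) abs_ge_zero] by (auto simp: abs_mult)
  qed measurable
  have int_R: "integrable M R"
    unfolding R_def by (intro Bochner_Integration.integrable_diff Bochner_Integration.integrable_sum int_p int_q int_\<phi>)
  have ER: "\<bar>expectation R\<bar> \<le> (real CARD('d))\<^sup>2 * (real K)\<^sup>2 / n"
  proof -
    have "\<bar>expectation R\<bar> \<le> expectation (\<lambda>\<omega>. \<bar>R \<omega>\<bar>)"
      by (rule integral_abs_bound)
    also have "\<dots> \<le> expectation (\<lambda>\<omega>. real CARD('d) * (\<Sum>j\<in>UNIV. (real K)\<^sup>2 * (\<Delta> n i j \<omega>)\<^sup>2))"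
      using int_\<Delta> int_R R_bound by (intro integral_mono) auto
    also have "\<dots> = real CARD('d) * (\<Sum>j\<in>UNIV. (real K)\<^sup>2 * expectation (\<lambda>\<omega>. (\<Delta> n i j \<omega>)\<^sup>2))"
      using int_\<Delta> by simp
    also have "\<dots> \<le> real CARD('d) * (\<Sum>j\<in>(UNIV :: 'd set). (real K)\<^sup>2 * (1 / n))"
      using i by (intro mult_left_mono sum_mono expectation_\<Delta>_sq_le) auto
    also have "\<dots> = (real CARD('d))\<^sup>2 * (real K)\<^sup>2 / n"
      by (simp add: power2_eq_square)
    finally show ?thesis .
  qed
  have E\<phi>: "\<bar>\<Sum>j\<in>UNIV. expectation (\<lambda>\<omega>. \<phi> j (X i \<omega>) * \<Delta> n i j \<omega>)\<bar> \<le> (real CARD('d))\<^sup>2 * (real K)\<^sup>2 / n"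
  proof -
    have "\<bar>\<Sum>j\<in>UNIV. expectation (\<lambda>\<omega>. \<phi> j (X i \<omega>) * \<Delta> n i j \<omega>)\<bar>
        \<le> (\<Sum>j\<in>UNIV. \<bar>expectation (\<lambda>\<omega>. \<phi> j (X i \<omega>) * \<Delta> n i j \<omega>)\<bar>)"
      by (rule sum_abs)
    also have "\<dots> \<le> (\<Sum>j\<in>(UNIV :: 'd set). (real K)\<^sup>2 / n)"
    proof (rule sum_mono)
      fix j
      show "\<bar>expectation (\<lambda>\<omega>. \<phi> j (X i \<omega>) * \<Delta> n i j \<omega>)\<bar> \<le> (real K)\<^sup>2 / n"
        by (rule abs_expectation_mult_\<Delta>_le) (use order.trans[OF \<phi>_bound l(2)] i in simp_all)
    qed
    also have "\<dots> = real CARD('d) * ((real K)\<^sup>2 / n)"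
      by simp
    also have "\<dots> \<le> (real CARD('d))\<^sup>2 * ((real K)\<^sup>2 / n)"
    proof (rule mult_right_mono)
      show "real CARD('d) \<le> (real CARD('d))\<^sup>2"
        by (metis le_square of_nat_le_iff of_nat_mult power2_eq_square)
    qed simp
    finally show ?thesis by simp
  qed
  have same: "expectation (\<lambda>\<omega>. \<Prod>j\<in>UNIV. p j \<omega>)
      = expectation (\<lambda>\<omega>. \<Prod>j\<in>UNIV. legendre (m j) (2 * F j (X 0 \<omega> $ j) - 1))"
  proof -
    let ?G = "\<lambda>x. \<Prod>j\<in>UNIV. legendre (m j) (2 * F j (x $ j) - 1)"
    have [measurable]: "?G \<in> borel_measurable borel"
      by measurable
    have "expectation (\<lambda>\<omega>. ?G (X k \<omega>)) = (LINT x|distr M borel (X k). ?G x)" for k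
      by (subst integral_distr) auto
    from this[of i] this[of 0] show ?thesis
      unfolding p_def ident[of i] by simp
  qed
  have "expectation (\<lambda>\<omega>. \<Prod>j\<in>UNIV. q j \<omega>)
      = expectation (\<lambda>\<omega>. (\<Prod>j\<in>UNIV. p j \<omega>) + ((\<Sum>j\<in>UNIV. \<phi> j (X i \<omega>) * \<Delta> n i j \<omega>) + R \<omega>))"
    by (simp add: R_def)
  also have "\<dots> = expectation (\<lambda>\<omega>. \<Prod>j\<in>UNIV. p j \<omega>)
      + ((\<Sum>j\<in>UNIV. expectation (\<lambda>\<omega>. \<phi> j (X i \<omega>) * \<Delta> n i j \<omega>)) + expectation R)"
    using int_p int_R int_\<phi> by simp
  finally show ?thesis
    using ER E\<phi> unfolding same q_def by simp
qed

end

section \<open>Convergence of the population series\<close>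

lemma unit_cube_indicator:
  "indicator unit_cube x = (\<Prod>j\<in>UNIV. indicator {0..1} (x $ j) :: real)"
proof (cases "x \<in> unit_cube")
  case True
  then show ?thesis by (simp add: unit_cube_def)
next
  case False
  then obtain j where "x $ j \<notin> {0..1}"
    by (auto simp: unit_cube_def)
  then have "\<exists>j\<in>UNIV. indicator {0..1} (x $ j) = (0 :: real)"
    by (auto simp: indicator_def)
  then have "(\<Prod>j\<in>UNIV. indicator {0..1} (x $ j) :: real) = 0"
    by simp
  then show ?thesis
    using False by simp
qed

lemma unit_cube_borel [measurable]: "unit_cube \<in> sets borel"
proof -
  have "unit_cube = (\<Inter>j. {x. 0 \<le> x $ j \<and> x $ j \<le> 1})"
    by (auto simp: unit_cube_def)
  also have "\<dots> \<in> sets borel"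
    by (intro sets.countable_INT'' borel_closed closed_Collect_conj closed_Collect_le continuous_intros)
      auto
  finally show ?thesis .
qed

text \<open>Fubini. \<open>lborel\<close> on \<open>real ^ 'd\<close> is the image of a product
  measure indexed by the basis vectors, so the work lies in matching the vector
  \<open>axis j 1\<close> with the coordinate \<open>j\<close>.\<close>

lemma integral_prod_vec:
  fixes f :: "'d::finite \<Rightarrow> real \<Rightarrow> real"
  assumes "\<And>j. integrable lborel (f j)"
  shows "integrable lborel (\<lambda>x::real^'d. \<Prod>j\<in>UNIV. f j (x $ j))"
    and "(LINT x|lborel. (\<Prod>j\<in>UNIV. f j ((x::real^'d) $ j))) = (\<Prod>j\<in>UNIV. LINT t|lborel. f j t)"
proof -
  interpret product_sigma_finite "\<lambda>_ :: real^'d. lborel :: real measure" ..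
  let ?B = "Basis :: (real^'d) set"
  let ?P = "\<Pi>\<^sub>M b\<in>?B. (lborel :: real measure)"
  let ?T = "\<lambda>g. \<Sum>b\<in>?B. g b *\<^sub>R b"
  have [measurable]: "f j \<in> borel_measurable borel" for j
    using borel_measurable_integrable[OF assms, of j] by simp
  have T: "?T \<in> measurable ?P borel"
    by measurable
  have meas: "(\<lambda>x::real^'d. \<Prod>j\<in>UNIV. f j (x $ j)) \<in> borel_measurable borel"
    by measurable
  have Basis: "?B = range (\<lambda>j. axis j 1)" and inj: "inj (\<lambda>j. axis j 1 :: real^'d)"
    by (auto simp: Basis_vec_def inj_on_def axis_eq_axis)
  have idx: "axis_index (axis j 1 :: real^'d) = j" for j
    by (metis axis_eq_axis axis_index axis_in_Basis_iff Basis_real_def insertI1 zero_neq_one)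
  have nth: "?T g $ j = g (axis j 1)" for g j
  proof -
    have "?T g $ j = (\<Sum>b\<in>?B. g b *\<^sub>R b) \<bullet> axis j 1"
      by (simp add: cart_eq_inner_axis)
    also have "\<dots> = g (axis j 1)"
      by (subst inner_sum_left_Basis) auto
    finally show ?thesis .
  qed
  have eq: "(\<Prod>j\<in>UNIV. f j (?T g $ j)) = (\<Prod>b\<in>?B. f (axis_index b) (g b))" for g
  proof -
    have "(\<Prod>b\<in>?B. f (axis_index b) (g b)) = (\<Prod>j\<in>UNIV. f j (g (axis j 1)))"
      unfolding Basis by (subst prod.reindex[OF inj]) (simp add: idx)
    then show ?thesis
      by (simp only: nth)
  qed
  show "integrable lborel (\<lambda>x::real^'d. \<Prod>j\<in>UNIV. f j (x $ j))"
    unfolding lborel_eq[where 'a="real^'d"] integrable_distr_eq[OF T meas] eq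
    by (intro product_integrable_prod assms) auto
  show "(LINT x|lborel. (\<Prod>j\<in>UNIV. f j ((x::real^'d) $ j))) = (\<Prod>j\<in>UNIV. LINT t|lborel. f j t)"
    unfolding lborel_eq[where 'a="real^'d"] integral_distr[OF T meas] eq
    by (subst product_integral_prod) (auto simp: assms Basis prod.reindex[OF inj] idx)
qed

lemma set_integral_cube_prod:
  fixes f :: "'d::finite \<Rightarrow> real \<Rightarrow> real"
  assumes "\<And>j. set_integrable lborel {0..1} (f j)"
  shows "set_integrable lborel unit_cube (\<lambda>x::real^'d. \<Prod>j\<in>UNIV. f j (x $ j))"
    and "(LINT x:unit_cube|lborel. (\<Prod>j\<in>UNIV. f j ((x::real^'d) $ j))) = (\<Prod>j\<in>UNIV. LINT t:{0..1}|lborel. f j t)"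
  using integral_prod_vec[of "\<lambda>j t. indicator {0..1} t * f j t"] assms
  by (simp_all add: set_integrable_def set_lebesgue_integral_def unit_cube_indicator prod.distrib)

section \<open>Legendre expansions of intervals and boxes\<close>

text \<open>Partial sum of the Legendre expansion of the indicator of \<open>{0..u}\<close>: the
  coefficients are its inner products with the basis functions.\<close>

definition indicator_series :: "nat \<Rightarrow> real \<Rightarrow> real \<Rightarrow> real" where
  "indicator_series n u x = (\<Sum>k\<le>n. integral {0..u} (shifted_legendre k) * shifted_legendre k x)"

lemma continuous_on_indicator_series [continuous_intros]:
  "continuous_on S (indicator_series n u)"
  unfolding indicator_series_def by (intro continuous_intros)

text \<open>The series is the orthogonal projection of the indicator onto the polynomials of degree
  at most \<open>n\<close>; therefore its squared norm and its inner product with the indicator are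
  the same \<open>s\<close>.\<close>

lemma indicator_series_integrals:
  fixes n :: nat and u :: real
  assumes u: "0 \<le> u" "u \<le> 1"
  defines "s \<equiv> (\<Sum>k\<le>n. (integral {0..u} (shifted_legendre k))\<^sup>2)"
  shows "set_integrable lborel {0..1} (\<lambda>x. (indicator_series n u x)\<^sup>2)"
    and "(LINT x:{0..1}|lborel. (indicator_series n u x)\<^sup>2) = s"
    and "set_integrable lborel {0..1} (\<lambda>x. indicator_series n u x * indicator {0..u} x)"
    and "(LINT x:{0..1}|lborel. indicator_series n u x * indicator {0..u} x) = s"
proof -
  define I where "I = (\<lambda>k. integral {0..u} (shifted_legendre k))"
  show int: "set_integrable lborel {0..1} (\<lambda>x. (indicator_series n u x)\<^sup>2)"
    by (intro borel_integrable_atLeastAtMost' continuous_intros)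
  have "((\<lambda>x. \<Sum>k\<le>n. \<Sum>l\<le>n. (I k * I l) * (shifted_legendre k x * shifted_legendre l x))
      has_integral (\<Sum>k\<le>n. \<Sum>l\<le>n. (I k * I l) * (if k = l then 1 else 0))) {0..1}"
    by (intro has_integral_sum has_integral_mult_right shifted_legendre_orthonormal) auto
  moreover have "(\<Sum>k\<le>n. \<Sum>l\<le>n. (I k * I l) * (shifted_legendre k x * shifted_legendre l x))
      = (indicator_series n u x)\<^sup>2" for x
    by (simp add: indicator_series_def I_def power2_eq_square sum_product mult_ac)
  moreover have "(\<Sum>k\<le>n. \<Sum>l\<le>n. (I k * I l) * (if k = l then 1 else 0)) = s"
    by (simp add: s_def I_def power2_eq_square if_distrib[of "(*) _"] cong: if_cong)
  ultimately have "((\<lambda>x. (indicator_series n u x)\<^sup>2) has_integral s) {0..1}"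
    by simp
  then show "(LINT x:{0..1}|lborel. (indicator_series n u x)\<^sup>2) = s"
    using set_borel_integral_eq_integral(2)[OF int] by (simp add: integral_unique)
  have int': "set_integrable lborel {0..u} (indicator_series n u)"
    by (intro borel_integrable_atLeastAtMost' continuous_intros)
  have ind: "indicator {0..1} x *\<^sub>R (indicator_series n u x * indicator {0..u} x)
      = indicator {0..u} x *\<^sub>R indicator_series n u x" for x
    using u by (auto simp: indicator_def)
  show "set_integrable lborel {0..1} (\<lambda>x. indicator_series n u x * indicator {0..u} x)"
    using int' by (simp only: set_integrable_def ind)
  have "(LINT x:{0..1}|lborel. indicator_series n u x * indicator {0..u} x)
      = (LINT x:{0..u}|lborel. indicator_series n u x)"
    by (simp only: set_lebesgue_integral_def ind)
  also have "\<dots> = integral {0..u} (indicator_series n u)"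
    by (rule set_borel_integral_eq_integral(2)[OF int'])
  also have "\<dots> = (\<Sum>k\<le>n. I k * I k)"
  proof (rule integral_unique)
    have series: "indicator_series n u = (\<lambda>x. \<Sum>k\<le>n. I k * shifted_legendre k x)"
      by (auto simp: indicator_series_def I_def)
    have "(shifted_legendre k has_integral I k) {0..u}" for k
      unfolding I_def by (intro integrable_integral integrable_continuous_real continuous_intros)
    then show "(indicator_series n u has_integral (\<Sum>k\<le>n. I k * I k)) {0..u}"
      unfolding series by (intro has_integral_sum has_integral_mult_right) auto
  qed
  also have "\<dots> = s"
    by (simp add: s_def I_def power2_eq_square)
  finally show "(LINT x:{0..1}|lborel. indicator_series n u x * indicator {0..u} x) = s" .
qed

text \<open>In this form a sum over multi-indices of a product factors into one-dimensional
  sums.\<close>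

lemma atMost_fun_eq_PiE: "{..N} = PiE UNIV (\<lambda>j. {..N j})"
  by (auto simp: le_fun_def PiE_def Pi_def)

text \<open>The products of one-dimensional partial sums converge to the indicator of the box in mean
  square: expanding the square turns the squared distance into \<open>\<Prod> u\<^sub>j - \<Prod> s\<^sub>j\<close>, where \<open>s\<^sub>j\<close> is the
  partial sum of Parseval's series for \<open>u\<^sub>j\<close>.\<close>

lemma legendre_series_box_integral:
  fixes c :: "real ^ 'd \<Rightarrow> real" and N :: "nat \<Rightarrow> 'd \<Rightarrow> nat"
  assumes c: "set_integrable lborel unit_cube c"
    and c2: "set_integrable lborel unit_cube (\<lambda>x. (c x)\<^sup>2)"
    and N: "\<And>j. filterlim (\<lambda>n. N n j) at_top sequentially"
    and u: "u \<in> unit_cube"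
  shows "(\<lambda>n. \<Sum>m\<in>{..N n}. legendre_coeff c m * (\<Prod>j\<in>UNIV. integral {0..u $ j} (shifted_legendre (m j))))
    \<longlonglongrightarrow> (LINT x:unit_cube|lborel. c x * (\<Prod>j\<in>UNIV. indicator {0..u $ j} (x $ j)))"
proof -
  define I where "I = (\<lambda>k j. integral {0..u $ j} (shifted_legendre k))"
  define h where "h = (\<lambda>n (x::real^'d). \<Prod>j\<in>UNIV. indicator_series (N n j) (u $ j) (x $ j))"
  define g where "g = (\<lambda>(x::real^'d). \<Prod>j\<in>UNIV. indicator {0..u $ j} (x $ j) :: real)"
  define s where "s = (\<lambda>n j. \<Sum>k\<le>N n j. (I k j)\<^sup>2)"
  have u01: "0 \<le> u $ j" "u $ j \<le> 1" for j
    using u by (auto simp: unit_cube_def)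
  have cm [measurable]: "(\<lambda>x. indicator unit_cube x * c x) \<in> borel_measurable borel"
    using borel_measurable_integrable[OF c[unfolded set_integrable_def]] by simp
  have bounded_mult: "set_integrable lborel unit_cube (\<lambda>x. c x * f x)"
    if f [measurable]: "f \<in> borel_measurable borel" and b: "\<And>x. x \<in> unit_cube \<Longrightarrow> \<bar>f x\<bar> \<le> B" for f B
    unfolding set_integrable_def
  proof (rule Bochner_Integration.integrable_bound)
    show "integrable lborel (\<lambda>x. B *\<^sub>R (indicator unit_cube x *\<^sub>R c x))"
      using c by (intro integrable_scaleR_right) (simp add: set_integrable_def)
    have "(\<lambda>x. (indicator unit_cube x * c x) * f x) \<in> borel_measurable borel"
      by measurable
    then show "(\<lambda>x. indicator unit_cube x *\<^sub>R (c x * f x)) \<in> borel_measurable lborel"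
      by (simp add: mult.assoc)
    have "\<bar>c x * f x\<bar> \<le> \<bar>B * c x\<bar>" if "x \<in> unit_cube" for x
      using mult_mono[OF b[OF that] order.refl[of "\<bar>c x\<bar>"]] order.trans[OF abs_ge_zero b[OF that]]
      by (simp add: abs_mult mult.commute)
    then show "AE x in lborel. norm (indicator unit_cube x *\<^sub>R (c x * f x))
        \<le> norm (B *\<^sub>R (indicator unit_cube x *\<^sub>R c x))"
      by (auto simp: indicator_def)
  qed
  have [measurable]: "indicator_series k v \<in> borel_measurable borel" for k v
    by (intro borel_measurable_continuous_onI continuous_intros)
  have [measurable]: "h n \<in> borel_measurable borel" "g \<in> borel_measurable borel" for n
    unfolding h_def g_def by measurable
  have cQ: "set_integrable lborel unit_cube (\<lambda>x. c x * (\<Prod>j\<in>UNIV. shifted_legendre (m j) (x $ j)))" for m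
  proof (rule bounded_mult)
    fix x :: "real^'d" assume "x \<in> unit_cube"
    then show "\<bar>\<Prod>j\<in>UNIV. shifted_legendre (m j) (x $ j)\<bar> \<le> (\<Prod>j\<in>UNIV. sqrt (2 * real (m j) + 1))"
      unfolding abs_prod by (intro prod_mono) (auto simp: unit_cube_def abs_shifted_legendre_le)
  qed measurable
  have h_eq: "h n x = (\<Sum>m\<in>{..N n}. (\<Prod>j\<in>UNIV. I (m j) j) * (\<Prod>j\<in>UNIV. shifted_legendre (m j) (x $ j)))" for n x
    unfolding h_def indicator_series_def I_def atMost_fun_eq_PiE
    by (subst prod_sum_PiE) (auto simp: prod.distrib)
  \<comment> \<open>The truncation moves from \<open>c\<close> to the box: the truncated series is
    the inner product of \<open>c\<close> with the projected indicator \<open>h n\<close>.\<close>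
  have series: "(\<Sum>m\<in>{..N n}. legendre_coeff c m * (\<Prod>j\<in>UNIV. I (m j) j))
      = (LINT x:unit_cube|lborel. c x * h n x)" and int_h: "set_integrable lborel unit_cube (\<lambda>x. c x * h n x)" for n
  proof -
    have fin: "finite {..N n}"
      unfolding atMost_fun_eq_PiE by (intro finite_PiE) auto
    have eq: "c x * h n x = (\<Sum>m\<in>{..N n}. (\<Prod>j\<in>UNIV. I (m j) j) * (c x * (\<Prod>j\<in>UNIV. shifted_legendre (m j) (x $ j))))" for x
      unfolding h_eq sum_distrib_left by (simp add: mult_ac)
    have int: "integrable lborel (\<lambda>x. indicator unit_cube x *\<^sub>R
        ((\<Prod>j\<in>UNIV. I (m j) j) * (c x * (\<Prod>j\<in>UNIV. shifted_legendre (m j) (x $ j)))))" for m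
      unfolding set_integrable_def[symmetric] by (intro set_integrable_mult_right cQ)
    show "(\<Sum>m\<in>{..N n}. legendre_coeff c m * (\<Prod>j\<in>UNIV. I (m j) j)) = (LINT x:unit_cube|lborel. c x * h n x)"
    proof -
      have "(LINT x:unit_cube|lborel. c x * h n x) = (\<Sum>m\<in>{..N n}. LINT x:unit_cube|lborel.
          (\<Prod>j\<in>UNIV. I (m j) j) * (c x * (\<Prod>j\<in>UNIV. shifted_legendre (m j) (x $ j))))"
        unfolding eq set_lebesgue_integral_def scaleR_sum_right
        by (rule Bochner_Integration.integral_sum[OF int])
      then show ?thesis
        by (simp add: legendre_coeff_def mult.commute)
    qed
    show "set_integrable lborel unit_cube (\<lambda>x. c x * h n x)"
      unfolding eq set_integrable_def scaleR_sum_right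
      by (rule Bochner_Integration.integrable_sum[OF int])
  qed
  have int_g: "set_integrable lborel unit_cube (\<lambda>x. c x * g x)"
    by (rule bounded_mult[where B=1])
      (auto simp: g_def abs_prod indicator_def intro!: prod_le_1)
  have h2: "set_integrable lborel unit_cube (\<lambda>x. (h n x)\<^sup>2)"
      "(LINT x:unit_cube|lborel. (h n x)\<^sup>2) = (\<Prod>j\<in>UNIV. s n j)" for n
    using set_integral_cube_prod[of "\<lambda>j x. (indicator_series (N n j) (u $ j) x)\<^sup>2"]
      indicator_series_integrals[OF u01]
    by (simp_all add: h_def s_def I_def prod_power_distrib)
  have hg: "set_integrable lborel unit_cube (\<lambda>x. h n x * g x)"
      "(LINT x:unit_cube|lborel. h n x * g x) = (\<Prod>j\<in>UNIV. s n j)" for n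
    using set_integral_cube_prod[of "\<lambda>j x. indicator_series (N n j) (u $ j) x * indicator {0..u $ j} x"]
      indicator_series_integrals[OF u01]
    by (simp_all add: h_def g_def s_def I_def prod.distrib)
  have g2: "set_integrable lborel unit_cube (\<lambda>x. (g x)\<^sup>2)"
      "(LINT x:unit_cube|lborel. (g x)\<^sup>2) = (\<Prod>j\<in>UNIV. u $ j)"
  proof -
    have ind: "indicator {0..1} x *\<^sub>R (indicator {0..u $ j} x :: real)\<^sup>2 = indicator {0..u $ j} x" for x j
      using u01[of j] by (auto simp: indicator_def)
    have "set_integrable lborel {0..1} (\<lambda>x. (indicator {0..u $ j} x :: real)\<^sup>2)" for j
      unfolding set_integrable_def ind by (intro integrable_real_indicator) (auto simp: emeasure_lborel_Icc_eq)
    moreover have "(LINT x:{0..1}|lborel. (indicator {0..u $ j} x :: real)\<^sup>2) = u $ j" for j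
      unfolding set_lebesgue_integral_def ind using u01[of j] by simp
    ultimately show "set_integrable lborel unit_cube (\<lambda>x. (g x)\<^sup>2)"
      "(LINT x:unit_cube|lborel. (g x)\<^sup>2) = (\<Prod>j\<in>UNIV. u $ j)"
      using set_integral_cube_prod[of "\<lambda>j x. (indicator {0..u $ j} x :: real)\<^sup>2"]
      by (simp_all add: g_def prod_power_distrib)
  qed
  define b where "b = (\<lambda>n. (\<Prod>j\<in>UNIV. u $ j) - (\<Prod>j\<in>UNIV. s n j))"
  have D2: "set_integrable lborel unit_cube (\<lambda>x. (h n x - g x)\<^sup>2)"
      "(LINT x:unit_cube|lborel. (h n x - g x)\<^sup>2) = b n" for n
  proof -
    have eq: "(h n x - g x)\<^sup>2 = (h n x)\<^sup>2 - 2 * (h n x * g x) + (g x)\<^sup>2" for x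
      by (simp add: power2_eq_square algebra_simps)
    show "set_integrable lborel unit_cube (\<lambda>x. (h n x - g x)\<^sup>2)"
      unfolding eq by (intro set_integral_add set_integral_diff set_integrable_mult_right h2 hg g2)
    have "(LINT x:unit_cube|lborel. (h n x - g x)\<^sup>2) = (\<Prod>j\<in>UNIV. s n j) - 2 * (\<Prod>j\<in>UNIV. s n j) + (\<Prod>j\<in>UNIV. u $ j)"
      unfolding eq
      by (subst set_integral_add set_integral_diff, intro set_integral_diff set_integrable_mult_right h2 hg g2, rule g2)+
        (simp add: h2 hg g2)
    then show "(LINT x:unit_cube|lborel. (h n x - g x)\<^sup>2) = b n"
      by (simp add: b_def)
  qed
  have b0: "b \<longlonglongrightarrow> 0"
  proof -
    have "(\<lambda>n. s n j) \<longlonglongrightarrow> u $ j" for j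
    proof (rule LIM_zero_cancel)
      have "(\<lambda>k. 1 / (2 * real k + 1)) \<longlonglongrightarrow> 0"
        by (rule Lim_null_comparison[OF always_eventually LIMSEQ_inverse_real_of_nat])
          (auto simp: field_simps)
      from filterlim_compose[OF this N[of j]]
      show "(\<lambda>n. s n j - u $ j) \<longlonglongrightarrow> 0"
        by (rule Lim_null_comparison[rotated])
          (auto simp: s_def I_def intro!: always_eventually sum_integral_shifted_legendre_sq_bound u01)
    qed
    then have "b \<longlonglongrightarrow> (\<Prod>j\<in>UNIV. u $ j) - (\<Prod>j\<in>UNIV. u $ j)"
      unfolding b_def by (intro tendsto_intros)
    then show ?thesis by simp
  qed
  define A where "A = (LINT x:unit_cube|lborel. (c x)\<^sup>2)"
  define a where "a = (\<lambda>n. (LINT x:unit_cube|lborel. c x * h n x) - (LINT x:unit_cube|lborel. c x * g x))"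
  have A: "A \<ge> 0"
    unfolding A_def set_lebesgue_integral_def by (intro Bochner_Integration.integral_nonneg) auto
  \<comment> \<open>Young's inequality with a free weight \<open>\<epsilon>\<close>, applied under
    the integral.\<close>
  have a_le: "\<bar>a n\<bar> \<le> \<epsilon> * A / 2 + b n / (2 * \<epsilon>)" if "\<epsilon> > 0" for \<epsilon> n
  proof -
    have "a n = (LINT x:unit_cube|lborel. c x * h n x - c x * g x)"
      unfolding a_def by (subst set_integral_diff(2)[OF int_h int_g]) simp
    also have "\<bar>\<dots>\<bar> \<le> (LINT x:unit_cube|lborel. \<epsilon> / 2 * (c x)\<^sup>2 + 1 / (2 * \<epsilon>) * (h n x - g x)\<^sup>2)"
      unfolding set_lebesgue_integral_def
    proof (rule order.trans[OF integral_abs_bound], rule integral_mono)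
      show "integrable lborel (\<lambda>x. \<bar>indicator unit_cube x *\<^sub>R (c x * h n x - c x * g x)\<bar>)"
        using set_integral_diff(1)[OF int_h int_g] unfolding set_integrable_def by (rule integrable_abs)
      show "integrable lborel (\<lambda>x. indicator unit_cube x *\<^sub>R (\<epsilon> / 2 * (c x)\<^sup>2 + 1 / (2 * \<epsilon>) * (h n x - g x)\<^sup>2))"
        unfolding set_integrable_def[symmetric]
        by (intro set_integral_add set_integrable_mult_right c2 D2)
      fix x
      have "\<bar>c x * (h n x - g x)\<bar> \<le> \<epsilon> / 2 * (c x)\<^sup>2 + 1 / (2 * \<epsilon>) * (h n x - g x)\<^sup>2"
      proof -
        define d where "d = h n x - g x"
        have "0 \<le> (\<epsilon> * \<bar>c x\<bar> - \<bar>d\<bar>)\<^sup>2 / (2 * \<epsilon>)"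
          using that by simp
        also have "\<dots> = \<epsilon> / 2 * (c x)\<^sup>2 + 1 / (2 * \<epsilon>) * d\<^sup>2 - \<bar>c x\<bar> * \<bar>d\<bar>"
          using that by (simp add: power2_diff power_mult_distrib field_simps power2_eq_square)
        finally show ?thesis
          by (simp add: abs_mult d_def)
      qed
      then show "\<bar>indicator unit_cube x *\<^sub>R (c x * h n x - c x * g x)\<bar>
          \<le> indicator unit_cube x *\<^sub>R (\<epsilon> / 2 * (c x)\<^sup>2 + 1 / (2 * \<epsilon>) * (h n x - g x)\<^sup>2)"
        by (auto simp: indicator_def right_diff_distrib)
    qed
    also have "\<dots> = \<epsilon> / 2 * A + 1 / (2 * \<epsilon>) * b n"
      by (subst set_integral_add(2)) (auto intro!: set_integrable_mult_right c2 D2 simp: A_def D2)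
    finally show ?thesis by simp
  qed
  have "a \<longlonglongrightarrow> 0"
  proof (rule LIMSEQ_I)
    fix r :: real assume r: "r > 0"
    \<comment> \<open>With this weight the first summand of \<open>a_le\<close> is at most
      \<open>r / 2\<close>; the added 1 avoids division by zero when \<open>A = 0\<close>.\<close>
    define \<epsilon> where "\<epsilon> = r / (A + 1)"
    have \<epsilon>: "\<epsilon> > 0"
      using r A by (simp add: \<epsilon>_def)
    have "\<epsilon> * A \<le> r"
      using r A by (simp add: \<epsilon>_def field_simps)
    have "eventually (\<lambda>n. b n < r * \<epsilon>) sequentially"
      using b0 r \<epsilon> by (intro order_tendstoD) auto
    then obtain n0 where n0: "\<And>n. n \<ge> n0 \<Longrightarrow> b n < r * \<epsilon>"
      by (auto simp: eventually_sequentially)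
    have "\<bar>a n\<bar> < r" if "n \<ge> n0" for n
    proof -
      have "b n / (2 * \<epsilon>) < r / 2"
        using n0[OF that] \<epsilon> by (simp add: field_simps)
      then show ?thesis
        using a_le[OF \<epsilon>, of n] \<open>\<epsilon> * A \<le> r\<close> by linarith
    qed
    then show "\<exists>n0. \<forall>n\<ge>n0. norm (a n - 0) < r"
      by auto
  qed
  then have "(\<lambda>n. LINT x:unit_cube|lborel. c x * h n x) \<longlonglongrightarrow> (LINT x:unit_cube|lborel. c x * g x)"
    unfolding a_def by (rule LIM_zero_cancel)
  then show ?thesis
    unfolding series[symmetric] by (simp add: I_def g_def)
qed

section \<open>Expectation of the series estimators\<close>

lemma has_integral_shifted_legendre:
  "(shifted_legendre m has_integral (if m = 0 then 1 else 0)) {0..1}"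
  using shifted_legendre_orthonormal[of m 0] by simp

context iid_sample
begin

section \<open>Probability integral transform and population coefficients\<close>

lemma pit_eq: "pit M (X 0) \<omega> $ j = F j (X 0 \<omega> $ j)"
  by (simp add: pit_def)

text \<open>Probability integral transform. \<open>F j\<close> may be constant on intervals and then
  has no inverse: a preimage of the level \<open>t\<close> bounds the probability from below,
  preimages of levels above \<open>t\<close> bound it from above.\<close>

lemma uniform_pit:
  assumes cont: "continuous_on UNIV (F j)"
  shows "distributed M lborel (\<lambda>\<omega>. F j (X 0 \<omega> $ j)) (\<lambda>x. indicator {0..1} x / measure lborel {0..1::real})"
proof (rule uniform_distrI_borel_atLeastAtMost)
  interpret R: real_distribution "distr M borel (\<lambda>\<omega>. X 0 \<omega> $ j)"
    by (rule real_distribution_marginal)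
  have mono: "F j x \<le> F j y" if "x \<le> y" for x y
    unfolding marginal_cdf_def using that by (rule R.cdf_nondecreasing)
  have cdf: "prob {\<omega> \<in> space M. X 0 \<omega> $ j \<le> x} = F j x" for x
    by (simp add: marginal_cdf_def cdf_def measure_distr vimage_def Int_def conj_commute)
  have attained: "\<exists>x. F j x = s" if s: "0 < s" "s < 1" for s
  proof -
    have "eventually (\<lambda>x. F j x < s) at_bot" "eventually (\<lambda>x. s < F j x) at_top"
      using R.cdf_lim_at_bot R.cdf_lim_at_top_prob s unfolding marginal_cdf_def
      by (auto intro: order_tendstoD)
    then obtain a b where ab: "\<And>x. x \<le> a \<Longrightarrow> F j x < s" "\<And>x. x \<ge> b \<Longrightarrow> s < F j x"
      by (auto simp: eventually_at_bot_linorder eventually_at_top_linorder)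
    \<comment> \<open>\<open>min\<close> and \<open>max\<close> order the endpoints for the
      intermediate value theorem, whichever of \<open>a\<close> and \<open>b\<close> is
      larger.\<close>
    have "\<exists>x. min a b \<le> x \<and> x \<le> max a b \<and> F j x = s"
      using ab(1)[of "min a b"] ab(2)[of "max a b"]
      by (intro IVT') (auto intro: continuous_on_subset[OF cont])
    then show ?thesis by blast
  qed
  fix t :: real assume t: "0 \<le> t" "t \<le> 1"
  let ?A = "{\<omega> \<in> space M. F j (X 0 \<omega> $ j) \<le> t}"
  have ge: "t \<le> prob ?A"
  proof (cases "0 < t \<and> t < 1")
    case True
    then obtain x where x: "F j x = t"
      using attained by blast
    have "prob {\<omega> \<in> space M. X 0 \<omega> $ j \<le> x} \<le> prob ?A"
      using mono[of _ x] x by (intro finite_measure_mono) auto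
    then show ?thesis
      by (simp add: cdf x)
  next
    case False
    then consider "t = 0" | "t = 1"
      using t by linarith
    then show ?thesis
    proof cases
      case 2
      then have "?A = space M"
        using F_bounds by auto
      then show ?thesis
        using 2 by (simp add: prob_space)
    qed simp
  qed
  have le: "prob ?A \<le> t"
  proof (rule ccontr)
    assume "\<not> prob ?A \<le> t"
    then have "t < prob ?A" by simp
    \<comment> \<open>If \<open>F j\<close> is flat at level \<open>t\<close>, the event can extend
      beyond a given preimage of \<open>t\<close>. A preimage of a strictly higher level lies to the
      right of all of it.\<close>
    then obtain s where s: "t < s" "s < prob ?A"
      using dense by blast
    then have "0 < s" "s < 1"
      using t order.strict_trans2[OF s(2) prob_le_1] by auto
    then obtain x where x: "F j x = s"
      using attained by blast
    have "prob ?A \<le> prob {\<omega> \<in> space M. X 0 \<omega> $ j \<le> x}"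
    proof (intro finite_measure_mono subsetI)
      fix \<omega> assume "\<omega> \<in> ?A"
      then show "\<omega> \<in> {\<omega> \<in> space M. X 0 \<omega> $ j \<le> x}"
        using mono[of x "X 0 \<omega> $ j"] x s by (auto simp: not_le intro: ccontr)
    qed measurable
    then show False
      using s by (simp add: cdf x)
  qed
  show "prob ?A = (t - 0) / (1 - 0)"
    using ge le by simp
qed auto

text \<open>Uniform margins and orthogonality to the constant polynomial. Hence the population
  coefficient vanishes whenever exactly one index is nonzero, in agreement with
  \<open>rho_hat\<close>.\<close>

lemma expectation_shifted_legendre_pit:
  assumes "continuous_on UNIV (F j)"
  shows "expectation (\<lambda>\<omega>. shifted_legendre m (F j (X 0 \<omega> $ j))) = (if m = 0 then 1 else 0)"
proof -
  have "expectation (\<lambda>\<omega>. shifted_legendre m (F j (X 0 \<omega> $ j)))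
      = (LINT x|lborel. indicator {0..1} x / measure lborel {0..1::real} * shifted_legendre m x)"
    by (intro distributed_integral[OF uniform_pit[OF assms], symmetric]) auto
  also have "\<dots> = (LINT x:{0..1}|lborel. shifted_legendre m x)"
    by (simp add: set_lebesgue_integral_def)
  also have "\<dots> = integral {0..1} (shifted_legendre m)"
    by (intro set_borel_integral_eq_integral(2) borel_integrable_atLeastAtMost' continuous_intros)
  also have "\<dots> = (if m = 0 then 1 else 0)"
    by (rule integral_unique[OF has_integral_shifted_legendre])
  finally show ?thesis .
qed

lemma expectation_copula_density:
  assumes c: "copula_density M (X 0) c" and [measurable]: "g \<in> borel_measurable borel"
  shows "expectation (\<lambda>\<omega>. g (pit M (X 0) \<omega>)) = (LINT u:unit_cube|lborel. c u * g u)"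
proof -
  have "expectation (\<lambda>\<omega>. g (pit M (X 0) \<omega>)) = (LINT u|lborel. indicator unit_cube u * c u * g u)"
    using c by (intro distributed_integral[symmetric]) (auto simp: copula_density_def indicator_def)
  then show ?thesis
    by (simp add: set_lebesgue_integral_def mult.assoc)
qed

lemma set_integrable_copula_density:
  assumes "copula_density M (X 0) c"
  shows "set_integrable lborel unit_cube c"
  using distributed_integrable[of M lborel "pit M (X 0)" "\<lambda>u. indicator unit_cube u * c u" "\<lambda>_. 1"] assms
  by (auto simp: copula_density_def set_integrable_def indicator_def)

lemma legendre_coeff_eq:
  assumes "copula_density M (X 0) c"
  shows "legendre_coeff c m = expectation (\<lambda>\<omega>. \<Prod>j\<in>UNIV. shifted_legendre (m j) (F j (X 0 \<omega> $ j)))"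
  unfolding legendre_coeff_def
  by (subst expectation_copula_density[OF assms, symmetric]) (simp_all add: pit_eq)

text \<open>The transformed observations are nonnegative, so the event defining the copula is
  membership in the box from 0 to \<open>u\<close>.\<close>

lemma copula_eq:
  assumes c: "copula_density M (X 0) c" and u: "u \<in> unit_cube"
  shows "copula M (X 0) u = (LINT x:unit_cube|lborel. c x * (\<Prod>j\<in>UNIV. indicator {0..u $ j} (x $ j)))"
proof -
  have "(LINT x:unit_cube|lborel. c x * (\<Prod>j\<in>UNIV. indicator {0..u $ j} (x $ j)))
      = expectation (\<lambda>\<omega>. \<Prod>j\<in>UNIV. indicator {0..u $ j} (pit M (X 0) \<omega> $ j))"
    by (rule expectation_copula_density[OF c, symmetric]) measurable
  also have "\<dots> = expectation (indicator {\<omega> \<in> space M. \<forall>j. pit M (X 0) \<omega> $ j \<le> u $ j})"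
  proof (intro Bochner_Integration.integral_cong refl)
    fix \<omega> assume "\<omega> \<in> space M"
    moreover have "0 \<le> pit M (X 0) \<omega> $ j" for j
      using F_bounds by (simp add: pit_eq)
    ultimately show "(\<Prod>j\<in>UNIV. indicator {0..u $ j} (pit M (X 0) \<omega> $ j) :: real)
        = indicator {\<omega> \<in> space M. \<forall>j. pit M (X 0) \<omega> $ j \<le> u $ j} \<omega>"
      by (cases "\<forall>j. pit M (X 0) \<omega> $ j \<le> u $ j") (auto simp: indicator_def)
  qed
  also have "\<dots> = copula M (X 0) u"
    by (simp add: copula_def Int_def conj_commute)
  finally show ?thesis by simp
qed

section \<open>Bias of the coefficients and of weighted sums\<close>

lemma prod_shifted_legendre:
  "(\<Prod>j\<in>UNIV. shifted_legendre (m j) (x j))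
    = (\<Prod>j\<in>(UNIV :: 'd set). sqrt (2 * real (m j) + 1)) * (\<Prod>j\<in>UNIV. legendre (m j) (2 * x j - 1))"
  by (simp add: shifted_legendre_def prod.distrib)

lemma integrable_prod_shifted_legendre_emp_cdf:
  "integrable M (\<lambda>\<omega>. \<Prod>j\<in>UNIV. shifted_legendre (m j) (emp_cdf X n \<omega> j (X i \<omega> $ j)))"
proof (rule integrable_const_bound[where B="\<Prod>j\<in>UNIV. sqrt (2 * real (m j) + 1)"])
  show "AE \<omega> in M. norm (\<Prod>j\<in>UNIV. shifted_legendre (m j) (emp_cdf X n \<omega> j (X i \<omega> $ j)))
      \<le> (\<Prod>j\<in>UNIV. sqrt (2 * real (m j) + 1))"
    unfolding real_norm_def abs_prod
    by (intro always_eventually allI prod_mono) (auto intro: abs_shifted_legendre_le emp_cdf_bounds)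
qed measurable

lemma integrable_rho_hat: "integrable M (rho_hat X n m)"
proof -
  \<comment> \<open>The case distinctions in \<open>rho_hat\<close> depend on \<open>m\<close> only,
    not on the outcome.\<close>
  have if_const: "integrable M (\<lambda>\<omega>. if b then f \<omega> else g \<omega>)"
    if "integrable M f" "integrable M g" for b and f g :: "'a \<Rightarrow> real"
    using that by (cases b) simp_all
  show ?thesis
    unfolding rho_hat_def[abs_def]
    by (intro if_const integrable_const integrable_mult_right Bochner_Integration.integrable_sum
        integrable_prod_shifted_legendre_emp_cdf)
qed

text \<open>The two fixed values of \<open>rho_hat\<close> are exact, by total mass 1 and by uniform
  margins. Otherwise the normalising factors come out of the product and
  \<open>empirical_legendre_bias\<close> bounds every summand of the average.\<close>

lemma rho_hat_bias:
  assumes cont: "\<And>j. continuous_on UNIV (F j)" and c: "copula_density M (X 0) c"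
    and n: "n > 0" and K: "\<And>j. m j * (m j + 1) \<le> K"
  shows "\<bar>expectation (rho_hat X n m) - legendre_coeff c m\<bar>
    \<le> (\<Prod>j\<in>UNIV. sqrt (2 * real (m j) + 1)) * (2 * (real CARD('d))\<^sup>2 * (real K)\<^sup>2 / n)"
proof -
  define A where "A = (\<Prod>j\<in>UNIV. sqrt (2 * real (m j) + 1))"
  define B where "B = 2 * (real CARD('d))\<^sup>2 * (real K)\<^sup>2 / n"
  have "0 \<le> A" "0 \<le> B"
    by (auto simp: A_def B_def intro!: prod_nonneg)
  then have pos: "0 \<le> A * B"
    by simp
  consider "\<forall>j. m j = 0" | "\<not> (\<forall>j. m j = 0)" "card {j. m j = 0} = CARD('d) - 1"
    | "\<not> (\<forall>j. m j = 0)" "card {j. m j = 0} \<noteq> CARD('d) - 1"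
    by blast
  then show ?thesis
    unfolding A_def[symmetric] B_def[symmetric]
  proof cases
    case 1
    then have "rho_hat X n m = (\<lambda>_. 1)"
      by (auto simp: rho_hat_def)
    then show "\<bar>expectation (rho_hat X n m) - legendre_coeff c m\<bar> \<le> A * B"
      using pos 1 by (simp add: legendre_coeff_eq[OF c] prob_space)
  next
    case 2
    have "card {j. m j \<noteq> 0} = CARD('d) - card {j. m j = 0}"
      by (subst card_Diff_subset[symmetric]) (auto intro!: arg_cong[where f=card])
    then have "card {j. m j \<noteq> 0} = 1"
      using 2 by simp
    then obtain k where k: "{j. m j \<noteq> 0} = {k}"
      by (auto simp: card_1_singleton_iff)
    then have zero: "m j = 0" if "j \<noteq> k" for j
      using that by blast
    have "(\<Prod>j\<in>UNIV. shifted_legendre (m j) (x j)) = shifted_legendre (m k) (x k)" for x :: "'d \<Rightarrow> real"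
      by (subst prod.remove[of _ k]) (auto simp: zero)
    then have "legendre_coeff c m = 0"
      using k by (auto simp: legendre_coeff_eq[OF c] expectation_shifted_legendre_pit[OF cont])
    moreover have "rho_hat X n m = (\<lambda>_. 0)"
      using 2 by (intro ext) (simp only: rho_hat_def if_False if_True simp_thms)
    ultimately show "\<bar>expectation (rho_hat X n m) - legendre_coeff c m\<bar> \<le> A * B"
      using pos by simp
  next
    case 3
    let ?e = "\<lambda>i. expectation (\<lambda>\<omega>. \<Prod>j\<in>UNIV. shifted_legendre (m j) (emp_cdf X n \<omega> j (X i \<omega> $ j)))"
    have e: "\<bar>?e i - legendre_coeff c m\<bar> \<le> A * B" if i: "i < n" for i
    proof -
      have "?e i - legendre_coeff c m
          = A * (expectation (\<lambda>\<omega>. \<Prod>j\<in>UNIV. legendre (m j) (2 * emp_cdf X n \<omega> j (X i \<omega> $ j) - 1))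
            - expectation (\<lambda>\<omega>. \<Prod>j\<in>UNIV. legendre (m j) (2 * F j (X 0 \<omega> $ j) - 1)))"
        unfolding legendre_coeff_eq[OF c] prod_shifted_legendre A_def by (simp add: right_diff_distrib)
      also have "\<bar>\<dots>\<bar> \<le> A * B"
        unfolding abs_mult abs_of_nonneg[OF \<open>0 \<le> A\<close>] B_def
        by (intro mult_left_mono \<open>0 \<le> A\<close> empirical_legendre_bias[where m=m, OF i K])
      finally show ?thesis .
    qed
    have "rho_hat X n m = (\<lambda>\<omega>. (1 / real n) *
        (\<Sum>i<n. \<Prod>j\<in>UNIV. shifted_legendre (m j) (emp_cdf X n \<omega> j (X i \<omega> $ j))))"
      using 3 by (intro ext) (simp only: rho_hat_def if_False simp_thms)
    then have "expectation (rho_hat X n m) - legendre_coeff c m = (\<Sum>i<n. ?e i - legendre_coeff c m) / n"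
      using n integrable_prod_shifted_legendre_emp_cdf by (simp add: sum_subtractf diff_divide_distrib)
    also have "\<bar>\<dots>\<bar> \<le> (\<Sum>i<n. \<bar>?e i - legendre_coeff c m\<bar>) / n"
      unfolding abs_divide abs_of_nat by (intro divide_right_mono sum_abs) simp
    also have "\<dots> \<le> (\<Sum>i<n. A * B) / n"
      by (intro divide_right_mono sum_mono e) simp_all
    also have "\<dots> = A * B"
      using n by simp
    finally show "\<bar>expectation (rho_hat X n m) - legendre_coeff c m\<bar> \<le> A * B" .
  qed
qed

lemma sum_odd_real: "(\<Sum>k\<le>n. 2 * real k + 1) = (real n + 1)\<^sup>2"
  by (induction n) (auto simp: power2_eq_square algebra_simps)

text \<open>Both \<open>c_hat\<close> and \<open>C_hat\<close> are linear in the empirical coefficients, with weights that are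
  bounded as in \<open>w\<close>.\<close>

lemma series_bias:
  assumes cont: "\<And>j. continuous_on UNIV (F j)" and c: "copula_density M (X 0) c"
    and n: "n > 0" and w: "\<And>m. \<bar>w m\<bar> \<le> (\<Prod>j\<in>UNIV. sqrt (2 * real (m j) + 1))"
    and L: "\<And>j. N j \<le> L"
  shows "\<bar>expectation (\<lambda>\<omega>. \<Sum>m\<in>{..N}. rho_hat X n m \<omega> * w m) - (\<Sum>m\<in>{..N}. legendre_coeff c m * w m)\<bar>
    \<le> 2 * (real CARD('d))\<^sup>2 * (real L + 1) ^ (2 * CARD('d) + 4) / n"
proof -
  define B where "B = 2 * (real CARD('d))\<^sup>2 * (real (L * (L + 1)))\<^sup>2 / n"
  have B: "B \<ge> 0"
    by (simp add: B_def)
  have fin: "finite {..N}"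
    unfolding atMost_fun_eq_PiE by (intro finite_PiE) auto
  have "expectation (\<lambda>\<omega>. \<Sum>m\<in>{..N}. rho_hat X n m \<omega> * w m) - (\<Sum>m\<in>{..N}. legendre_coeff c m * w m)
      = (\<Sum>m\<in>{..N}. (expectation (rho_hat X n m) - legendre_coeff c m) * w m)"
    using integrable_rho_hat by (simp add: left_diff_distrib sum_subtractf)
  also have "\<bar>\<dots>\<bar> \<le> (\<Sum>m\<in>{..N}. \<bar>(expectation (rho_hat X n m) - legendre_coeff c m) * w m\<bar>)"
    by (rule sum_abs)
  also have "\<dots> \<le> (\<Sum>m\<in>{..N}. B * (\<Prod>j\<in>UNIV. 2 * real (m j) + 1))"
  proof (rule sum_mono)
    fix m assume "m \<in> {..N}"
    then have mL: "m j \<le> L" for j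
      using L[of j] by (auto simp: le_fun_def intro: order.trans)
    define A where "A = (\<Prod>j\<in>UNIV. sqrt (2 * real (m j) + 1))"
    have "\<bar>expectation (rho_hat X n m) - legendre_coeff c m\<bar> \<le> A * B"
      unfolding A_def B_def using mL by (intro rho_hat_bias cont c n mult_le_mono) auto
    \<comment> \<open>One factor \<open>A\<close> comes from the coefficient and one from the
      weight; the roots disappear, and the sum over \<open>{..N}\<close> then factors into sums of
      odd numbers.\<close>
    then have "\<bar>(expectation (rho_hat X n m) - legendre_coeff c m) * w m\<bar> \<le> (A * B) * A"
      unfolding abs_mult using w[of m] by (intro mult_mono) (auto simp: A_def intro: order.trans[OF abs_ge_zero])
    also have "\<dots> = B * (A * A)"
      by simp
    also have "A * A = (\<Prod>j\<in>UNIV. 2 * real (m j) + 1)"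
      by (simp add: A_def prod.distrib[symmetric])
    finally show "\<bar>(expectation (rho_hat X n m) - legendre_coeff c m) * w m\<bar> \<le> B * (\<Prod>j\<in>UNIV. 2 * real (m j) + 1)" .
  qed
  also have "\<dots> = B * (\<Prod>j\<in>UNIV. \<Sum>k\<le>N j. 2 * real k + 1)"
    unfolding sum_distrib_left[symmetric] atMost_fun_eq_PiE by (subst prod_sum_PiE) auto
  also have "\<dots> = B * (\<Prod>j\<in>UNIV. (real (N j) + 1)\<^sup>2)"
    by (simp only: sum_odd_real)
  also have "\<dots> \<le> B * (\<Prod>j\<in>(UNIV :: 'd set). (real L + 1)\<^sup>2)"
    using L by (intro mult_left_mono prod_mono B conjI power_mono) auto
  also have "(\<Prod>j\<in>(UNIV :: 'd set). (real L + 1)\<^sup>2) = (real L + 1) ^ (2 * CARD('d))"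
    by (simp add: power_mult)
  \<comment> \<open>The exponents add up: \<open>2 * CARD('d)\<close> from the sum over
    multi-indices, 4 from squaring \<open>L * (L + 1) \<le> (L + 1)\<^sup>2\<close>.\<close>
  also have "B * (real L + 1) ^ (2 * CARD('d))
      \<le> (2 * (real CARD('d))\<^sup>2 * (real L + 1) ^ 4 / n) * (real L + 1) ^ (2 * CARD('d))"
  proof -
    have "(real (L * (L + 1)))\<^sup>2 \<le> ((real L + 1) * (real L + 1))\<^sup>2"
      by (intro power_mono) (auto simp: algebra_simps)
    also have "\<dots> = (real L + 1) ^ 4"
      by (simp add: power2_eq_square power4_eq_xxxx mult_ac)
    finally show ?thesis
      unfolding B_def by (intro mult_right_mono divide_right_mono mult_left_mono) auto
  qed
  also have "\<dots> = 2 * (real CARD('d))\<^sup>2 * (real L + 1) ^ (2 * CARD('d) + 4) / n"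
    by (simp add: power_add)
  finally show ?thesis .
qed

end

text \<open>Once the bias is shown to vanish, truncation remains. For \<open>c_hat\<close> it is
  controlled by the convergence of the Legendre series at \<open>u\<close>, the premise of the first
  claim; for \<open>C_hat\<close> by the mean-square convergence of the box expansions.\<close>

theorem proposition7:
  fixes M :: "'a measure"
    and X :: "nat \<Rightarrow> 'a \<Rightarrow> real ^ 'd"
    and c :: "real ^ 'd \<Rightarrow> real"
    and N :: "nat \<Rightarrow> 'd \<Rightarrow> nat"
  assumes "prob_space M"
    and "CARD('d) \<ge> 2"
    and "prob_space.indep_vars M (\<lambda>_. borel) X UNIV"
    and "\<And>i. distr M borel (X i) = distr M borel (X 0)"
    and "\<And>j. continuous_on UNIV (marginal_cdf M (X 0) j)"
    and "copula_density M (X 0) c"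
    and "set_integrable lborel unit_cube (\<lambda>u. (c u)\<^sup>2)"
    and "\<And>j. filterlim (\<lambda>n. N n j) at_top sequentially"
    and "(\<lambda>n. real (Max (range (N n))) ^ (2 * CARD('d) + 4)) \<in> o(\<lambda>n. real n)"
  shows "\<forall>u\<in>unit_cube.
      (legendre_representable_at c u \<longrightarrow>
         (\<lambda>n. prob_space.expectation M (c_hat X n (N n) u)) \<longlonglongrightarrow> c u) \<and>
      (\<lambda>n. prob_space.expectation M (C_hat X n (N n) u)) \<longlonglongrightarrow> copula M (X 0) u"
proof (intro ballI conjI impI)
  fix u :: "real ^ 'd" assume u: "u \<in> unit_cube"
  interpret iid_sample M X
    using assms(1,3,4) by (simp add: iid_sample_def iid_sample_axioms_def)
  note cont = assms(5) and c = assms(6)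
  define L where "L = (\<lambda>n. Max (range (N n)))"
  define p where "p = 2 * CARD('d) + 4"
  have L: "N n j \<le> L n" for n j
    by (simp add: L_def)
  have rate: "(\<lambda>n. 2 * (real CARD('d))\<^sup>2 * (real (L n) + 1) ^ p / n) \<longlonglongrightarrow> 0"
  proof -
    have "eventually (\<lambda>n. norm (2 * (real CARD('d))\<^sup>2 * (real (L n) + 1) ^ p / n)
        \<le> 2 * (real CARD('d))\<^sup>2 * 2 ^ p * (real (L n) ^ p / n)) sequentially"
      \<comment> \<open>\<open>undefined\<close> is an arbitrary coordinate. Once its order is at
        least 1, so is \<open>L n\<close>, and \<open>real (L n) + 1\<close> is at most twice
        \<open>real (L n)\<close>.\<close>
      using filterlim_at_top[THEN iffD1, OF assms(8)[of undefined], rule_format, of 1]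
    proof eventually_elim
      case (elim n)
      then have "1 \<le> real (L n)"
        using L[of n undefined] by linarith
      then have "(real (L n) + 1) ^ p \<le> (2 * real (L n)) ^ p"
        by (intro power_mono) auto
      then have "2 * (real CARD('d))\<^sup>2 * (real (L n) + 1) ^ p / n
          \<le> 2 * (real CARD('d))\<^sup>2 * (2 * real (L n)) ^ p / n"
        by (intro divide_right_mono mult_left_mono) auto
      also have "\<dots> = 2 * (real CARD('d))\<^sup>2 * 2 ^ p * (real (L n) ^ p / n)"
        by (simp add: power_mult_distrib)
      finally show ?case
        by simp
    qed
    then show ?thesis
    proof (rule Lim_null_comparison)
      show "(\<lambda>n. 2 * (real CARD('d))\<^sup>2 * 2 ^ p * (real (L n) ^ p / n)) \<longlonglongrightarrow> 0"
        using assms(9) unfolding L_def p_def by (intro tendsto_mult_right_zero smalloD_tendsto)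
    qed
  qed
  have bias: "(\<lambda>n. expectation (\<lambda>\<omega>. \<Sum>m\<in>{..N n}. rho_hat X n m \<omega> * w m)
      - (\<Sum>m\<in>{..N n}. legendre_coeff c m * w m)) \<longlonglongrightarrow> 0"
    if "\<And>m. \<bar>w m\<bar> \<le> (\<Prod>j\<in>UNIV. sqrt (2 * real (m j) + 1))" for w
  proof (rule Lim_null_comparison[OF _ rate])
    show "eventually (\<lambda>n. norm (expectation (\<lambda>\<omega>. \<Sum>m\<in>{..N n}. rho_hat X n m \<omega> * w m)
        - (\<Sum>m\<in>{..N n}. legendre_coeff c m * w m)) \<le> 2 * (real CARD('d))\<^sup>2 * (real (L n) + 1) ^ p / n) sequentially"
      using eventually_gt_at_top[of 0] unfolding real_norm_def p_def
      by eventually_elim (rule series_bias[OF cont c _ that L])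
  qed
  have u01: "0 \<le> u $ j" "u $ j \<le> 1" for j
    using u by (auto simp: unit_cube_def)
  {
    assume repr: "legendre_representable_at c u"
    \<comment> \<open>Multi-indices are not linearly ordered, so \<open>at_top\<close> is unfolded
      into its generating sets; the finitely many coordinates eventually dominate \<open>K\<close>
      together.\<close>
    have "filterlim N (\<Sqinter>K. principal {K..}) sequentially"
      unfolding filterlim_INF filterlim_principal
    proof
      fix K :: "'d \<Rightarrow> nat"
      have "eventually (\<lambda>n. \<forall>j\<in>UNIV. K j \<le> N n j) sequentially"
        using assms(8) by (intro eventually_ball_finite) (auto simp: filterlim_at_top)
      then show "eventually (\<lambda>n. N n \<in> {K..}) sequentially"
        by (simp add: le_fun_def)
    qed
    then have "filterlim N at_top sequentially"
      unfolding at_top_def .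
    then have "(\<lambda>n. legendre_partial_sum c (N n) u) \<longlonglongrightarrow> c u"
      using repr unfolding legendre_representable_at_def by (rule filterlim_compose[rotated])
    moreover have "(\<lambda>n. expectation (c_hat X n (N n) u) - legendre_partial_sum c (N n) u) \<longlonglongrightarrow> 0"
      unfolding c_hat_def[abs_def] legendre_partial_sum_def
    proof (rule bias)
      show "\<bar>\<Prod>j\<in>UNIV. shifted_legendre (m j) (u $ j)\<bar> \<le> (\<Prod>j\<in>UNIV. sqrt (2 * real (m j) + 1))" for m
        unfolding abs_prod by (intro prod_mono) (auto simp: u01 abs_shifted_legendre_le)
    qed
    ultimately show "(\<lambda>n. expectation (c_hat X n (N n) u)) \<longlonglongrightarrow> c u"
      using tendsto_add by fastforce
  }
  let ?w = "\<lambda>m. \<Prod>j\<in>UNIV. integral {0..u $ j} (shifted_legendre (m j))"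
  have "(\<lambda>n. expectation (C_hat X n (N n) u) - (\<Sum>m\<in>{..N n}. legendre_coeff c m * ?w m)) \<longlonglongrightarrow> 0"
    unfolding C_hat_def[abs_def]
  proof (rule bias)
    show "\<bar>?w m\<bar> \<le> (\<Prod>j\<in>UNIV. sqrt (2 * real (m j) + 1))" for m
      unfolding abs_prod by (intro prod_mono) (auto simp: u01 abs_integral_shifted_legendre_le)
  qed
  moreover have "(\<lambda>n. \<Sum>m\<in>{..N n}. legendre_coeff c m * ?w m) \<longlonglongrightarrow> copula M (X 0) u"
    unfolding copula_eq[OF c u]
    by (rule legendre_series_box_integral[OF set_integrable_copula_density[OF c] assms(7,8) u])
  ultimately show "(\<lambda>n. expectation (C_hat X n (N n) u)) \<longlonglongrightarrow> copula M (X 0) u"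
    using tendsto_add by fastforce
qed

end
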